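(* Let $(\mathfrak g,[\cdot,\cdot],[\![\cdot,\cdot,\cdot]\!])$ be a Lie-Yamaguti algebra, $(V;\rho,\mu)$ a representation of it, and let $\mathcal C^\bullet(\mathfrak g,\rho,\mu)=\bigoplus_{n\ge 0}\mathcal C^n(\mathfrak g,\rho,\mu)$ and $\Delta:\mathcal C^{p}(\mathfrak g,\rho,\mu)\to\mathcal C^{p+1}(\mathfrak g,\rho,\mu)$ be the graded vector space and the coboundary map of the pair $(\mathfrak g,\rho,\mu)$. Then $\Delta\circ\Delta=0$, so that $(\mathcal C^\bullet(\mathfrak g,\rho,\mu),\Delta)$ is a well-defined cochain complex.
   Context: All vector spaces are finite-dimensional over a field $\mathbb K$ of characteristic $0$. A Lie-Yamaguti algebra is a vector space $\mathfrak g$ with a bilinear map $[\cdot,\cdot]:\wedge^2\mathfrak g\to\mathfrak g$ and a trilinear map $[\![\cdot,\cdot,\cdot]\!]:\wedge^2\mathfrak g\otimes\mathfrak g\to\mathfrak g$ such that for all $x,y,z,w,t\in\mathfrak g$: (1) $[[x,y],z]+[[y,z],x]+[[z,x],y]+[\![x,y,z]\!]+[\![y,z,x]\!]+[\![z,x,y]\!]=0$; (2) $[\![[x,y],z,w]\!]+[\![[y,z],x,w]\!]+[\![[z,x],y,w]\!]=0$; (3) $[\![x,y,[z,w]]\!]=[[\![x,y,z]\!],w]+[z,[\![x,y,w]\!]]$; (4) $[\![x,y,[\![z,w,t]\!]]\!]=[\![[\![x,y,z]\!],w,t]\!]+[\![z,[\![x,y,w]\!],t]\!]+[\![z,w,[\![x,y,t]\!]]\!]$.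 A representation $(V;\rho,\mu)$ of $\mathfrak g$ is a vector space $V$ with linear maps $\rho:\mathfrak g\to\mathfrak{gl}(V)$, $\mu:\otimes^2\mathfrak g\to\mathfrak{gl}(V)$ such that, with $D(x,y)=D_{\rho,\mu}(x,y):=\mu(y,x)-\mu(x,y)+[\rho(x),\rho(y)]-\rho([x,y])$, for all $x,y,z,w\in\mathfrak g$: $\mu([x,y],z)-\mu(x,z)\rho(y)+\mu(y,z)\rho(x)=0$; $\mu(x,[y,z])-\rho(y)\mu(x,z)+\rho(z)\mu(x,y)=0$; $\rho([\![x,y,z]\!])=[D(x,y),\rho(z)]$; $\mu(z,w)\mu(x,y)-\mu(y,w)\mu(x,z)-\mu(x,[\![y,z,w]\!])+D(y,z)\mu(x,w)=0$; $\mu([\![x,y,z]\!],w)+\mu(z,[\![x,y,w]\!])=[D(x,y),\mu(z,w)]$. Adjoint representation of $\mathfrak g$: $\rho=\mathrm{ad}$, $\mathrm{ad}_xz=[x,z]$; $\mu=\mathfrak R$, $\mathfrak R_{x,y}z=[\![z,x,y]\!]$; then $D(x,y)z=[\![x,y,z]\!]$. Semidirect product Lie-Yamaguti algebra $\mathfrak g\ltimes V$: the space $\mathfrak g\oplus V$ with $[x+u,y+v]_\ltimes=[x,y]+\rho(x)v-\rho(y)u$ and $[\![x+u,y+v,z+w]\!]_\ltimes=[\![x,y,z]\!]+D(x,y)w+\mu(y,z)u-\mu(x,z)v$. Yamaguti complex of a Lie-Yamaguti algebra $\mathfrak g$ with coefficients in a representation $(V;\rho,\mu)$: $C^1_{\rm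 LieY}(\mathfrak g,V)=\mathrm{Hom}(\mathfrak g,V)$ and, for $n\ge1$, $C^{n+1}_{\rm LieY}(\mathfrak g,V)=\mathrm{Hom}((\wedge^2\mathfrak g)^{\otimes n},V)\times\mathrm{Hom}((\wedge^2\mathfrak g)^{\otimes n}\otimes\mathfrak g,V)$. For $f\in C^1_{\rm LieY}$, $\delta f=(\delta_{\rm I}f,\delta_{\rm II}f)$ with $\delta_{\rm I}f(x,y)=\rho(x)f(y)-\rho(y)f(x)-f([x,y])$, $\delta_{\rm II}f(x,y,z)=D(x,y)f(z)+\mu(y,z)f(x)-\mu(x,z)f(y)-f([\![x,y,z]\!])$. For $n\ge1$, $(f,g)\in C^{n+1}_{\rm LieY}$, $X_i=x_i\wedge y_i$, $X_k\circ X_l=[\![x_k,y_k,x_l]\!]\wedge y_l+x_l\wedge[\![x_k,y_k,y_l]\!]$, $\delta(f,g)=(\delta_{\rm I}(f,g),\delta_{\rm II}(f,g))$ with $\delta_{\rm I}(f,g)(X_1,\dots,X_{n+1})=(-1)^n\big(\rho(x_{n+1})g(X_1,\dots,X_n,y_{n+1})-\rho(y_{n+1})g(X_1,\dots,X_n,x_{n+1})-g(X_1,\dots,X_n,[x_{n+1},y_{n+1}])\big)+\sum_{k=1}^n(-1)^{k+1}D(X_k)f(X_1,\dots,\hat X_k,\dots,X_{n+1})+\sum_{1\le k<l\le n+1}(-1)^kf(X_1,\dots,\hat X_k,\dots,X_k\circ X_l,\dots,X_{n+1})$, $\delta_{\rm II}(f,g)(X_1,\dots,X_{n+1},z)=(-1)^n\big(\mu(y_{n+1},z)g(X_1,\dots,X_n,x_{n+1})-\mu(x_{n+1},z)g(X_1,\dots,X_n,y_{n+1})\big)+\sum_{k=1}^{n+1}(-1)^{k+1}D(X_k)g(X_1,\dots,\hat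 X_k,\dots,X_{n+1},z)+\sum_{1\le k<l\le n+1}(-1)^kg(X_1,\dots,\hat X_k,\dots,X_k\circ X_l,\dots,X_{n+1},z)+\sum_{k=1}^{n+1}(-1)^kg(X_1,\dots,\hat X_k,\dots,X_{n+1},[\![x_k,y_k,z]\!])$. The cochain spaces of the pair $(\mathfrak g,\rho,\mu)$: $\mathcal C^0=0$, $\mathcal C^1=\mathfrak{gl}(\mathfrak g)\times\mathfrak{gl}(V)$, and for $n\ge1$, $\mathcal C^{n+1}(\mathfrak g,\rho,\mu)$ is the direct sum of (a) $\mathrm{Hom}((\wedge^2\mathfrak g)^{\otimes n},\mathfrak g)\times\mathrm{Hom}((\wedge^2\mathfrak g)^{\otimes n}\otimes\mathfrak g,\mathfrak g)\ni(f_1,g_1)$; (b) $\mathrm{Hom}((\wedge^2\mathfrak g)^{\otimes(n-1)}\otimes(\mathfrak g\wedge V),V)\times\mathrm{Hom}((\wedge^2\mathfrak g)^{\otimes n}\otimes V,V)\ni(f_2,g_2)$; (c) $\bigoplus_{i=1}^{n-1}\mathrm{Hom}((\wedge^2\mathfrak g)^{\otimes(i-1)}\otimes(\mathfrak g\wedge V)\otimes(\wedge^2\mathfrak g)^{\otimes(n-i)},V)\times\bigoplus_{j=1}^{n}\mathrm{Hom}((\wedge^2\mathfrak g)^{\otimes(j-1)}\otimes(\mathfrak g\wedge V)\otimes(\wedge^2\mathfrak g)^{\otimes(n-j)}\otimes\mathfrak g,V)\ni((f_3^{i})_i,(g_3^{j})_j)$. Here $\mathfrak g\wedge V\cong\mathfrak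 g\otimes V$ is the mixed part of $\wedge^2(\mathfrak g\oplus V)$. Lift to $C^{\bullet}_{\rm LieY}(\mathfrak g\oplus V,\mathfrak g\oplus V)$ (cochains of $\mathfrak g\ltimes V$): for $(f_1,f_2)\in\mathcal C^1$, $\hat f(x+u)=f_1(x)+f_2(u)$; for $n\ge1$, $(\hat f,\hat g)$ is obtained by extending each component multilinearly (and skew-symmetrically within each $\wedge^2$ slot) by zero to all inputs in $\mathfrak g\oplus V$ not of its prescribed type, and adding up. E.g. $f_2$ contributes $f_2(X_1,\dots,X_{n-1},x_n\wedge v_n)-f_2(X_1,\dots,X_{n-1},y_n\wedge u_n)$ on $((x_i+u_i)\wedge(y_i+v_i))_{i=1}^n$, where $X_i=x_i\wedge y_i$. Thus $\mathcal C^p(\mathfrak g,\rho,\mu)$ is identified with the subspace of cochains taking all-$\mathfrak g$ inputs to $\mathfrak g$, inputs with exactly one $V$-entry to $V$, and vanishing when two or more entries lie in $V$. The coboundary $\Delta:\mathcal C^p\to\mathcal C^{p+1}$: $\Delta(f,g)$ (resp. $\Delta f$ for $p=1$) is the element whose components are obtained from $\delta(\hat f,\hat g)$ (resp. $\delta\hat f$), where $\delta$ is the Yamaguti coboundary of $\mathfrak g\ltimes V$ with coefficients in its adjoint representation, by restricting it to inputs of each of the types listed in (a), (b), (c), and taking the $\mathfrak g$-component of the value for type (a) and the $V$-component for types (b), (c). For $p=0$, $\Delta=0$. *)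

theory Defs
  imports Complex_Main "HOL-Library.Function_Algebras" "HOL-Library.Product_Plus"
begin

section \<open>Lie-Yamaguti algebras and their representations\<close>

locale lie_yamaguti_algebra = vector_space sg
  for sg :: "'k::field_char_0 \<Rightarrow> 'g::ab_group_add \<Rightarrow> 'g" +
  fixes br :: "'g \<Rightarrow> 'g \<Rightarrow> 'g"
    and tr :: "'g \<Rightarrow> 'g \<Rightarrow> 'g \<Rightarrow> 'g"
  assumes br_linear1: "Vector_Spaces.linear sg sg (\<lambda>x. br x y)"
    and br_linear2: "Vector_Spaces.linear sg sg (\<lambda>y. br x y)"
    and br_alt: "br x x = 0"
    and tr_linear1: "Vector_Spaces.linear sg sg (\<lambda>x. tr x y z)"
    and tr_linear2: "Vector_Spaces.linear sg sg (\<lambda>y. tr x y z)"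
    and tr_linear3: "Vector_Spaces.linear sg sg (\<lambda>z. tr x y z)"
    and tr_alt: "tr x x z = 0"
    and LY1: "br (br x y) z + br (br y z) x + br (br z x) y + tr x y z + tr y z x + tr z x y = 0"
    and LY2: "tr (br x y) z w + tr (br y z) x w + tr (br z x) y w = 0"
    and LY3: "tr x y (br z w) = br (tr x y z) w + br z (tr x y w)"
    and LY4: "tr x y (tr z w t) = tr (tr x y z) w t + tr z (tr x y w) t + tr z w (tr x y t)"

definition rep_D ::
  "('g \<Rightarrow> 'g \<Rightarrow> 'g) \<Rightarrow> ('g \<Rightarrow> 'v \<Rightarrow> 'v) \<Rightarrow> ('g \<Rightarrow> 'g \<Rightarrow> 'v \<Rightarrow> 'v) \<Rightarrow> 'g \<Rightarrow> 'g \<Rightarrow> 'v \<Rightarrow> 'v::ab_group_add"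
  where "rep_D br \<rho> \<mu> x y v =
    \<mu> y x v - \<mu> x y v + (\<rho> x (\<rho> y v) - \<rho> y (\<rho> x v)) - \<rho> (br x y) v"

locale ly_representation = lie_yamaguti_algebra sg br tr + V: vector_space sv
  for sg :: "'k::field_char_0 \<Rightarrow> 'g::ab_group_add \<Rightarrow> 'g"
    and br :: "'g \<Rightarrow> 'g \<Rightarrow> 'g"
    and tr :: "'g \<Rightarrow> 'g \<Rightarrow> 'g \<Rightarrow> 'g"
    and sv :: "'k \<Rightarrow> 'v::ab_group_add \<Rightarrow> 'v" +
  fixes \<rho> :: "'g \<Rightarrow> 'v \<Rightarrow> 'v"
    and \<mu> :: "'g \<Rightarrow> 'g \<Rightarrow> 'v \<Rightarrow> 'v"
  assumes rho_linear1: "Vector_Spaces.linear sg sv (\<lambda>x. \<rho> x v)"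
    and rho_linear2: "Vector_Spaces.linear sv sv (\<lambda>v. \<rho> x v)"
    and mu_linear1: "Vector_Spaces.linear sg sv (\<lambda>x. \<mu> x y v)"
    and mu_linear2: "Vector_Spaces.linear sg sv (\<lambda>y. \<mu> x y v)"
    and mu_linear3: "Vector_Spaces.linear sv sv (\<lambda>v. \<mu> x y v)"
    and rep1: "\<mu> (br x y) z v - \<mu> x z (\<rho> y v) + \<mu> y z (\<rho> x v) = 0"
    and rep2: "\<mu> x (br y z) v - \<rho> y (\<mu> x z v) + \<rho> z (\<mu> x y v) = 0"
    and rep3: "\<rho> (tr x y z) v = rep_D br \<rho> \<mu> x y (\<rho> z v) - \<rho> z (rep_D br \<rho> \<mu> x y v)"
    and rep4: "\<mu> z w (\<mu> x y v) - \<mu> y w (\<mu> x z v) - \<mu> x (tr y z w) v + rep_D br \<rho> \<mu> y z (\<mu> x w v) = 0"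
    and rep5: "\<mu> (tr x y z) w v + \<mu> z (tr x y w) v
      = rep_D br \<rho> \<mu> x y (\<mu> z w v) - \<mu> z w (rep_D br \<rho> \<mu> x y v)"

definition adj_mu :: "('g \<Rightarrow> 'g \<Rightarrow> 'g \<Rightarrow> 'g) \<Rightarrow> 'g \<Rightarrow> 'g \<Rightarrow> 'g \<Rightarrow> 'g"
  where "adj_mu tr x y z = tr z x y"

definition semi_br ::
  "('g \<Rightarrow> 'g \<Rightarrow> 'g) \<Rightarrow> ('g \<Rightarrow> 'v \<Rightarrow> 'v::ab_group_add) \<Rightarrow> 'g \<times> 'v \<Rightarrow> 'g \<times> 'v \<Rightarrow> 'g \<times> 'v"
  where "semi_br br \<rho> = (\<lambda>(x, u) (y, v). (br x y, \<rho> x v - \<rho> y u))"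

definition semi_tr ::
  "('g \<Rightarrow> 'g \<Rightarrow> 'g) \<Rightarrow> ('g \<Rightarrow> 'g \<Rightarrow> 'g \<Rightarrow> 'g) \<Rightarrow> ('g \<Rightarrow> 'v \<Rightarrow> 'v::ab_group_add) \<Rightarrow> ('g \<Rightarrow> 'g \<Rightarrow> 'v \<Rightarrow> 'v)
    \<Rightarrow> 'g \<times> 'v \<Rightarrow> 'g \<times> 'v \<Rightarrow> 'g \<times> 'v \<Rightarrow> 'g \<times> 'v"
  where "semi_tr br tr \<rho> \<mu> = (\<lambda>(x, u) (y, v) (z, w).
    (tr x y z, rep_D br \<rho> \<mu> x y w + \<mu> y z u - \<mu> x z v))"


section \<open>The Yamaguti coboundary\<close>

text \<open>
  An element of $\mathrm{Hom}((\wedge^2\mathfrak a)^{\otimes n},W)$ is a function on lists of pairs: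
  its value at $[(x_1,y_1),\dots,(x_n,y_n)]$ is the value at
  $(x_1\wedge y_1)\otimes\dots\otimes(x_n\wedge y_n)$. It is set to \<open>0\<close> on lists of any other
  length, so that equality of functions is equality of cochains.
\<close>

definition wedge_hom ::
  "('k::field \<Rightarrow> 'a::ab_group_add \<Rightarrow> 'a) \<Rightarrow> ('k \<Rightarrow> 'w::ab_group_add \<Rightarrow> 'w) \<Rightarrow> nat \<Rightarrow> (('a \<times> 'a) list \<Rightarrow> 'w) \<Rightarrow> bool"
  where "wedge_hom s t n f \<longleftrightarrow>
    (\<forall>X. length X \<noteq> n \<longrightarrow> f X = 0) \<and>
    (\<forall>X i. length X = n \<longrightarrow> i < n \<longrightarrow>
      (\<forall>y. Vector_Spaces.linear s t (\<lambda>x. f (X[i := (x, y)]))) \<and>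
      (\<forall>x. Vector_Spaces.linear s t (\<lambda>y. f (X[i := (x, y)]))) \<and>
      (\<forall>x. f (X[i := (x, x)]) = 0))"

definition signed :: "nat \<Rightarrow> 'w \<Rightarrow> 'w::ab_group_add"
  where "signed k w = (if even k then w else - w)"

text \<open>Positions in lists of arguments are numbered from \<open>1\<close>: $X_k$ is \<open>X ! (k - 1)\<close>.\<close>

definition omit :: "nat \<Rightarrow> 'a list \<Rightarrow> 'a list"
  where "omit k X = take (k - 1) X @ drop k X"

text \<open>
  The value of \<open>f\<close> at $(X_1,\dots,\hat X_k,\dots,X_k\circ X_l,\dots)$ for $k<l$. As $X_k\circ X_l$
  is a sum of two decomposable elements, this is a sum of two values of \<open>f\<close>.
\<close>

definition circ_eval ::
  "('a \<Rightarrow> 'a \<Rightarrow> 'a \<Rightarrow> 'a) \<Rightarrow> nat \<Rightarrow> nat \<Rightarrow> (('a \<times> 'a) list \<Rightarrow> 'w) \<Rightarrow> ('a \<times> 'a) list \<Rightarrow> 'w::ab_group_add"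
  where "circ_eval tr k l f X =
    (let (xk, yk) = X ! (k - 1); (xl, yl) = X ! (l - 1) in
      f (omit k (X[l - 1 := (tr xk yk xl, yl)])) + f (omit k (X[l - 1 := (xl, tr xk yk yl)])))"

text \<open>
  The coboundary of a Lie-Yamaguti algebra \<open>(br, tr)\<close> with coefficients in \<open>(\<rho>, \<mu>)\<close>:
  \<open>yam_delta1\<close> on degree \<open>1\<close>, and \<open>yam_delta n\<close> on degree \<open>n + 1\<close> for \<open>n \<ge> 1\<close>.
\<close>

definition yam_delta1 ::
  "('a \<Rightarrow> 'a \<Rightarrow> 'a) \<Rightarrow> ('a \<Rightarrow> 'a \<Rightarrow> 'a \<Rightarrow> 'a) \<Rightarrow> ('a \<Rightarrow> 'w \<Rightarrow> 'w) \<Rightarrow> ('a \<Rightarrow> 'a \<Rightarrow> 'w \<Rightarrow> 'w)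
    \<Rightarrow> ('a \<Rightarrow> 'w::ab_group_add) \<Rightarrow> (('a \<times> 'a) list \<Rightarrow> 'w) \<times> (('a \<times> 'a) list \<Rightarrow> 'a \<Rightarrow> 'w)"
  where "yam_delta1 br tr \<rho> \<mu> f =
    ((\<lambda>X. case X of [(x, y)] \<Rightarrow> \<rho> x (f y) - \<rho> y (f x) - f (br x y) | _ \<Rightarrow> 0),
     (\<lambda>X z. case X of
        [(x, y)] \<Rightarrow> rep_D br \<rho> \<mu> x y (f z) + \<mu> y z (f x) - \<mu> x z (f y) - f (tr x y z)
      | _ \<Rightarrow> 0))"

definition yam_delta_I ::
  "('a \<Rightarrow> 'a \<Rightarrow> 'a) \<Rightarrow> ('a \<Rightarrow> 'a \<Rightarrow> 'a \<Rightarrow> 'a) \<Rightarrow> ('a \<Rightarrow> 'w \<Rightarrow> 'w) \<Rightarrow> ('a \<Rightarrow> 'a \<Rightarrow> 'w \<Rightarrow> 'w) \<Rightarrow> nat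
    \<Rightarrow> (('a \<times> 'a) list \<Rightarrow> 'w) \<Rightarrow> (('a \<times> 'a) list \<Rightarrow> 'a \<Rightarrow> 'w) \<Rightarrow> ('a \<times> 'a) list \<Rightarrow> 'w::ab_group_add"
  where "yam_delta_I br tr \<rho> \<mu> n f g X =
    (if length X = n + 1 then
       (let x = fst (X ! n); y = snd (X ! n); Y = take n X in
          signed n (\<rho> x (g Y y) - \<rho> y (g Y x) - g Y (br x y)))
       + (\<Sum>k = 1..n. signed (k + 1)
            (rep_D br \<rho> \<mu> (fst (X ! (k - 1))) (snd (X ! (k - 1))) (f (omit k X))))
       + (\<Sum>l = 1..n + 1. \<Sum>k = 1..<l. signed k (circ_eval tr k l f X))
     else 0)"

definition yam_delta_II ::
  "('a \<Rightarrow> 'a \<Rightarrow> 'a) \<Rightarrow> ('a \<Rightarrow> 'a \<Rightarrow> 'a \<Rightarrow> 'a) \<Rightarrow> ('a \<Rightarrow> 'w \<Rightarrow> 'w) \<Rightarrow> ('a \<Rightarrow> 'a \<Rightarrow> 'w \<Rightarrow> 'w) \<Rightarrow> nat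
    \<Rightarrow> (('a \<times> 'a) list \<Rightarrow> 'a \<Rightarrow> 'w) \<Rightarrow> ('a \<times> 'a) list \<Rightarrow> 'a \<Rightarrow> 'w::ab_group_add"
  where "yam_delta_II br tr \<rho> \<mu> n g X z =
    (if length X = n + 1 then
       (let x = fst (X ! n); y = snd (X ! n); Y = take n X in
          signed n (\<mu> y z (g Y x) - \<mu> x z (g Y y)))
       + (\<Sum>k = 1..n + 1. signed (k + 1)
            (rep_D br \<rho> \<mu> (fst (X ! (k - 1))) (snd (X ! (k - 1))) (g (omit k X) z)))
       + (\<Sum>l = 1..n + 1. \<Sum>k = 1..<l. signed k (circ_eval tr k l (\<lambda>Y. g Y z) X))
       + (\<Sum>k = 1..n + 1. signed k
            (g (omit k X) (tr (fst (X ! (k - 1))) (snd (X ! (k - 1))) z)))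
     else 0)"

definition yam_delta ::
  "('a \<Rightarrow> 'a \<Rightarrow> 'a) \<Rightarrow> ('a \<Rightarrow> 'a \<Rightarrow> 'a \<Rightarrow> 'a) \<Rightarrow> ('a \<Rightarrow> 'w \<Rightarrow> 'w) \<Rightarrow> ('a \<Rightarrow> 'a \<Rightarrow> 'w \<Rightarrow> 'w) \<Rightarrow> nat
    \<Rightarrow> (('a \<times> 'a) list \<Rightarrow> 'w::ab_group_add) \<times> (('a \<times> 'a) list \<Rightarrow> 'a \<Rightarrow> 'w)
    \<Rightarrow> (('a \<times> 'a) list \<Rightarrow> 'w) \<times> (('a \<times> 'a) list \<Rightarrow> 'a \<Rightarrow> 'w)"
  where "yam_delta br tr \<rho> \<mu> n = (\<lambda>(f, g).
    (yam_delta_I br tr \<rho> \<mu> n f g, yam_delta_II br tr \<rho> \<mu> n g))"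


section \<open>Cochains of the pair\<close>

text \<open>
  The components $(f_1,g_1,f_2,g_2,f_3,g_3)$ of a cochain of degree at least \<open>2\<close>. An argument in
  $\mathfrak g\wedge V\cong\mathfrak g\otimes V$ is passed as two arguments \<open>x\<close>, \<open>v\<close>, standing for
  $x\wedge v$. The families $f_3$, $g_3$ take the superscript as their first argument, followed by
  the arguments before the mixed slot, the mixed slot, and the arguments after it.
\<close>

type_synonym ('g, 'v) components =
  "(('g \<times> 'g) list \<Rightarrow> 'g) \<times>
   (('g \<times> 'g) list \<Rightarrow> 'g \<Rightarrow> 'g) \<times>
   (('g \<times> 'g) list \<Rightarrow> 'g \<Rightarrow> 'v \<Rightarrow> 'v) \<times>
   (('g \<times> 'g) list \<Rightarrow> 'v \<Rightarrow> 'v) \<times>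
   (nat \<Rightarrow> ('g \<times> 'g) list \<Rightarrow> 'g \<Rightarrow> 'v \<Rightarrow> ('g \<times> 'g) list \<Rightarrow> 'v) \<times>
   (nat \<Rightarrow> ('g \<times> 'g) list \<Rightarrow> 'g \<Rightarrow> 'v \<Rightarrow> ('g \<times> 'g) list \<Rightarrow> 'g \<Rightarrow> 'v)"

text \<open>
  All degrees live in one type: the first factor carries the elements of degree \<open>1\<close>, the second one
  those of degree at least \<open>2\<close>.
\<close>

type_synonym ('g, 'v) pair_cochain = "(('g \<Rightarrow> 'g) \<times> ('v \<Rightarrow> 'v)) \<times> ('g, 'v) components"

text \<open>
  $\mathrm{Hom}((\wedge^2\mathfrak g)^{\otimes a}\otimes(\mathfrak g\wedge V)\otimes(\wedge^2\mathfrak g)^{\otimes b},V)$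
\<close>

definition mixed_hom ::
  "('k::field \<Rightarrow> 'g::ab_group_add \<Rightarrow> 'g) \<Rightarrow> ('k \<Rightarrow> 'v::ab_group_add \<Rightarrow> 'v) \<Rightarrow> nat \<Rightarrow> nat
    \<Rightarrow> (('g \<times> 'g) list \<Rightarrow> 'g \<Rightarrow> 'v \<Rightarrow> ('g \<times> 'g) list \<Rightarrow> 'v) \<Rightarrow> bool"
  where "mixed_hom sg sv a b f \<longleftrightarrow>
    (\<forall>x v Y. wedge_hom sg sv a (\<lambda>X. f X x v Y)) \<and>
    (\<forall>X v Y. Vector_Spaces.linear sg sv (\<lambda>x. f X x v Y)) \<and>
    (\<forall>X x Y. Vector_Spaces.linear sv sv (\<lambda>v. f X x v Y)) \<and>
    (\<forall>X x v. wedge_hom sg sv b (\<lambda>Y. f X x v Y))"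

text \<open>The components of the elements of degree \<open>n + 1\<close>, for \<open>n \<ge> 1\<close>.\<close>

definition components_space ::
  "('k::field \<Rightarrow> 'g::ab_group_add \<Rightarrow> 'g) \<Rightarrow> ('k \<Rightarrow> 'v::ab_group_add \<Rightarrow> 'v) \<Rightarrow> nat \<Rightarrow> ('g, 'v) components set"
  where "components_space sg sv n = {(f1, g1, f2, g2, f3, g3).
    wedge_hom sg sg n f1 \<and>
    (\<forall>z. wedge_hom sg sg n (\<lambda>X. g1 X z)) \<and> (\<forall>X. Vector_Spaces.linear sg sg (g1 X)) \<and>
    (\<forall>x v. wedge_hom sg sv (n - 1) (\<lambda>X. f2 X x v)) \<and>
    (\<forall>X v. Vector_Spaces.linear sg sv (\<lambda>x. f2 X x v)) \<and>
    (\<forall>X x. Vector_Spaces.linear sv sv (\<lambda>v. f2 X x v)) \<and>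
    (\<forall>v. wedge_hom sg sv n (\<lambda>X. g2 X v)) \<and> (\<forall>X. Vector_Spaces.linear sv sv (g2 X)) \<and>
    (\<forall>i \<in> {1..n - 1}. mixed_hom sg sv (i - 1) (n - i) (f3 i)) \<and>
    (\<forall>i. i \<notin> {1..n - 1} \<longrightarrow> f3 i = 0) \<and>
    (\<forall>j \<in> {1..n}.
      (\<forall>z. mixed_hom sg sv (j - 1) (n - j) (\<lambda>X x v Y. g3 j X x v Y z)) \<and>
      (\<forall>X x v Y. Vector_Spaces.linear sg sv (g3 j X x v Y))) \<and>
    (\<forall>j. j \<notin> {1..n} \<longrightarrow> g3 j = 0)}"

definition pair_cochains ::
  "('k::field \<Rightarrow> 'g::ab_group_add \<Rightarrow> 'g) \<Rightarrow> ('k \<Rightarrow> 'v::ab_group_add \<Rightarrow> 'v) \<Rightarrow> nat \<Rightarrow> ('g, 'v) pair_cochain set"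
  where "pair_cochains sg sv p =
    (if p = 0 then {0}
     else if p = 1 then ({f1. Vector_Spaces.linear sg sg f1} \<times> {f2. Vector_Spaces.linear sv sv f2}) \<times> {0}
     else {0} \<times> components_space sg sv (p - 1))"

definition pair_scale ::
  "('k \<Rightarrow> 'g \<Rightarrow> 'g) \<Rightarrow> ('k \<Rightarrow> 'v \<Rightarrow> 'v) \<Rightarrow> 'k \<Rightarrow> ('g, 'v) pair_cochain \<Rightarrow> ('g, 'v) pair_cochain"
  where "pair_scale sg sv c = (\<lambda>((h1, h2), (f1, g1, f2, g2, f3, g3)).
    ((\<lambda>x. sg c (h1 x), \<lambda>u. sv c (h2 u)),
     (\<lambda>X. sg c (f1 X), \<lambda>X z. sg c (g1 X z),
      \<lambda>X x v. sv c (f2 X x v), \<lambda>X v. sv c (g2 X v),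
      \<lambda>i X x v Y. sv c (f3 i X x v Y), \<lambda>j X x v Y z. sv c (g3 j X x v Y z))))"


section \<open>Lift, restriction and the coboundary of the pair\<close>

definition lift1 :: "('g \<Rightarrow> 'g) \<times> ('v \<Rightarrow> 'v) \<Rightarrow> 'g \<times> 'v \<Rightarrow> 'g \<times> 'v"
  where "lift1 = (\<lambda>(f1, f2) (x, u). (f1 x, f2 u))"

definition g_pair :: "('g \<times> 'v) \<times> ('g \<times> 'v) \<Rightarrow> 'g \<times> 'g"
  where "g_pair = (\<lambda>((x, u), (y, v)). (x, y))"

text \<open>
  The part of $(x+u)\wedge(y+v)$ in $\mathfrak g\wedge V$ is $x\wedge v-y\wedge u$; hence the
  value at $(x+u)\wedge(y+v)$ of the extension by zero of a map on $\mathfrak g\wedge V$.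
\<close>

definition mixed_ext :: "('g \<Rightarrow> 'v \<Rightarrow> 'w) \<Rightarrow> ('g \<times> 'v) \<times> ('g \<times> 'v) \<Rightarrow> 'w::ab_group_add"
  where "mixed_ext h = (\<lambda>((x, u), (y, v)). h x v - h y u)"

definition lift ::
  "nat \<Rightarrow> ('g::ab_group_add, 'v::ab_group_add) components
    \<Rightarrow> ((('g \<times> 'v) \<times> ('g \<times> 'v)) list \<Rightarrow> 'g \<times> 'v) \<times> ((('g \<times> 'v) \<times> ('g \<times> 'v)) list \<Rightarrow> 'g \<times> 'v \<Rightarrow> 'g \<times> 'v)"
  where "lift n = (\<lambda>(f1, g1, f2, g2, f3, g3).
    ((\<lambda>X. if length X = n then
        (f1 (map g_pair X),
         mixed_ext (f2 (map g_pair (take (n - 1) X))) (X ! (n - 1))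
         + (\<Sum>i = 1..n - 1. mixed_ext
              (\<lambda>x v. f3 i (map g_pair (take (i - 1) X)) x v (map g_pair (drop i X))) (X ! (i - 1))))
      else 0),
     (\<lambda>X (z, w). if length X = n then
        (g1 (map g_pair X) z,
         g2 (map g_pair X) w
         + (\<Sum>j = 1..n. mixed_ext
              (\<lambda>x v. g3 j (map g_pair (take (j - 1) X)) x v (map g_pair (drop j X)) z) (X ! (j - 1))))
      else 0)))"

definition in_pair :: "'g \<times> 'g \<Rightarrow> ('g \<times> 'v::zero) \<times> ('g \<times> 'v)"
  where "in_pair = (\<lambda>(x, y). ((x, 0), (y, 0)))"

definition restr ::
  "nat \<Rightarrow> ((('g \<times> 'v) \<times> ('g \<times> 'v)) list \<Rightarrow> 'g \<times> 'v) \<times> ((('g \<times> 'v) \<times> ('g \<times> 'v)) list \<Rightarrow> 'g \<times> 'v \<Rightarrow> 'g \<times> 'v)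
    \<Rightarrow> ('g::ab_group_add, 'v::ab_group_add) components"
  where "restr n = (\<lambda>(F, G).
    (\<lambda>X. fst (F (map in_pair X)),
     \<lambda>X z. fst (G (map in_pair X) (z, 0)),
     \<lambda>X x v. snd (F (map in_pair X @ [((x, 0), (0, v))])),
     \<lambda>X v. snd (G (map in_pair X) (0, v)),
     \<lambda>i X x v Y. if i \<in> {1..n - 1} \<and> length X = i - 1 \<and> length Y = n - i
       then snd (F (map in_pair X @ [((x, 0), (0, v))] @ map in_pair Y)) else 0,
     \<lambda>j X x v Y z. if j \<in> {1..n} \<and> length X = j - 1 \<and> length Y = n - j
       then snd (G (map in_pair X @ [((x, 0), (0, v))] @ map in_pair Y) (z, 0)) else 0))"

definition pair_delta ::
  "('g \<Rightarrow> 'g \<Rightarrow> 'g) \<Rightarrow> ('g \<Rightarrow> 'g \<Rightarrow> 'g \<Rightarrow> 'g) \<Rightarrow> ('g \<Rightarrow> 'v \<Rightarrow> 'v) \<Rightarrow> ('g \<Rightarrow> 'g \<Rightarrow> 'v \<Rightarrow> 'v) \<Rightarrow> nat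
    \<Rightarrow> ('g::ab_group_add, 'v::ab_group_add) pair_cochain \<Rightarrow> ('g, 'v) pair_cochain"
  where "pair_delta br tr \<rho> \<mu> p c =
    (let B = semi_br br \<rho>; T = semi_tr br tr \<rho> \<mu> in
     if p = 0 then 0
     else if p = 1 then (0, restr 1 (yam_delta1 B T B (adj_mu T) (lift1 (fst c))))
     else (0, restr p (yam_delta B T B (adj_mu T) (p - 1) (lift (p - 1) (snd c)))))"


section \<open>Cochain complexes\<close>

definition cochain_complex ::
  "('k::field \<Rightarrow> 'c::ab_group_add \<Rightarrow> 'c) \<Rightarrow> (nat \<Rightarrow> 'c set) \<Rightarrow> (nat \<Rightarrow> 'c \<Rightarrow> 'c) \<Rightarrow> bool"
  where "cochain_complex s C d \<longleftrightarrow>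
    vector_space s \<and>
    (\<forall>p. module.subspace s (C p)) \<and>
    (\<forall>p. d p ` C p \<subseteq> C (Suc p)) \<and>
    (\<forall>p. \<forall>c \<in> C p. \<forall>c' \<in> C p. d p (c + c') = d p c + d p c') \<and>
    (\<forall>p a. \<forall>c \<in> C p. d p (s a c) = s a (d p c)) \<and>
    (\<forall>p. \<forall>c \<in> C p. d (Suc p) (d p c) = 0)"

end

theory Submission
  imports Defs
begin

text \<open>
  The proof rests on two ideas.

  \<^emph>\<open>The Yamaguti complex is a Leibniz complex.\<close> For a Lie-Yamaguti algebra $\mathfrak a$ the product
  $X\circ Y$ makes $\wedge^2\mathfrak a$ a Leibniz algebra. A representation \<open>V\<close> gives coefficients
  $M=V\oplus\mathrm{Hom}(\mathfrak a,V)$ for it: an element \<open>X\<close> acts on \<open>V\<close> by \<open>D X\<close>, on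
  $\mathrm{Hom}(\mathfrak a,V)$ by the induced derivation, and a degree-zero element \<open>(v, h)\<close> has the
  coboundary $X\mapsto(\delta_{\rm I}h(X),\delta_{\rm II}h(X))$, the pair that defines $\delta$ on the lowest
  degree. A pair $(f,g)$ of degree \<open>n + 1\<close> is then the same as an \<open>n\<close>-cochain
  $X\mapsto(f(X),g(X))$ with values in \<open>M\<close>, and $\delta_{\rm I}$, $\delta_{\rm II}$ are the two components of a
  single coboundary \<open>d\<close> (\<open>yam_delta_eq_coboundary\<close>). For \<open>d\<close> Cartan's formula
  $\iota_X d+d\,\iota_X=L_X$ can be used as a recursive definition; the signed sums disappear, and
  $d\,d=0$ (\<open>coboundary_coboundary\<close>) follows by induction on the degree from $[L_X,d]=0$
  (\<open>coboundary_lie_derivative\<close>). The axioms of a representation enter only through three identities between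
  the two actions on \<open>M\<close>, checked in \<open>leibniz_coefficients_coeff\<close>.

  \<^emph>\<open>The cochains of the pair are the cochains that commute with an automorphism.\<close> The map
  $\sigma(x+u)=x+2u$ is an automorphism of $\mathfrak g\ltimes V$. If \<open>k\<close> of the arguments of a multilinear
  map \<open>F\<close> lie in \<open>V\<close> and the others in $\mathfrak g$, applying $\sigma$ to all of them multiplies the
  value by $2^k$, while applying $\sigma$ to the value multiplies its components by $1$ and $2$. In
  characteristic zero the powers of $2$ are distinct, so $F\circ\sigma=\sigma\circ F$ says exactly that
  inputs from $\mathfrak g$ are taken to $\mathfrak g$, inputs with one entry in \<open>V\<close> are taken to \<open>V\<close>, and all
  others to zero. Hence \<open>lift\<close> is a bijection from the components onto these cochains, with inverse
  \<open>restr\<close> (\<open>restr_lift\<close>, \<open>lift_restr\<close>). As the coboundary is built from the brackets, it preserves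
  commutation with an automorphism (\<open>equivariant_yam_delta\<close>), so $\delta\,\hat c$ is again the lift of
  $\Delta c$ and $\Delta\Delta c$ is the restriction of $\delta\delta\,\hat c=0$. Linearity of
  $\Delta$ and the subspace properties are transported along the same bijection.
\<close>

section \<open>Alternating multilinear functions of a list of pairs\<close>

lemma signed_simps [simp]:
  "signed k (0::'w::ab_group_add) = 0"
  "signed 0 w = (w::'w)"
  "signed (Suc k) w = - signed k w"
  by (auto simp: signed_def)

lemma signed_add: "signed k (a + b) = signed k a + signed k (b::'w::ab_group_add)"
  by (auto simp: signed_def)

context vector_space_pair
begin

lemma linear_def_iff:
  "Vector_Spaces.linear s1 s2 f \<longleftrightarrow> (\<forall>x y. f (x + y) = f x + f y) \<and> (\<forall>c x. f (s1 c x) = s2 c (f x))"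
  by (simp add: Vector_Spaces.linear_iff vs1.vector_space_axioms vs2.vector_space_axioms)

lemma wedge_hom_0: "wedge_hom s1 s2 0 F \<longleftrightarrow> (\<forall>X. X \<noteq> [] \<longrightarrow> F X = 0)"
  by (simp add: wedge_hom_def)

text \<open>
  All inductions on the degree run through this: being alternating multilinear is a condition on the
  first pair together with the same condition, one degree lower, on the remaining ones.
\<close>
lemma wedge_hom_Suc:
  "wedge_hom s1 s2 (Suc n) F \<longleftrightarrow>
     F [] = 0 \<and> (\<forall>p. wedge_hom s1 s2 n (\<lambda>Z. F (p # Z))) \<and>
     (\<forall>y Z. Vector_Spaces.linear s1 s2 (\<lambda>x. F ((x, y) # Z))) \<and>
     (\<forall>x Z. Vector_Spaces.linear s1 s2 (\<lambda>y. F ((x, y) # Z))) \<and>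
     (\<forall>x Z. F ((x, x) # Z) = 0)" (is "?L \<longleftrightarrow> ?R")
proof
  assume L: ?L
  then have off: "length X \<noteq> Suc n \<Longrightarrow> F X = 0" for X by (auto simp: wedge_hom_def)
  have slot: "Vector_Spaces.linear s1 s2 (\<lambda>x. F (X[i := (x, y)]))" "Vector_Spaces.linear s1 s2 (\<lambda>y. F (X[i := (x, y)]))"
    "F (X[i := (x, x)]) = 0" if "length X = Suc n" "i < Suc n" for X i x y
    using L that by (auto simp: wedge_hom_def)
  have "wedge_hom s1 s2 n (\<lambda>Z. F (p # Z))" for p
    unfolding wedge_hom_def
  proof (intro conjI allI impI, goal_cases)
    case (1 X) then show ?case by (simp add: off)
  next
    case (2 X i y) then show ?case using slot(1)[of "p # X" "Suc i" y] by simp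
  next
    case (3 X i x) then show ?case using slot(2)[of "p # X" "Suc i" x] by simp
  next
    case (4 X i x) then show ?case using slot(3)[of "p # X" "Suc i" x] by simp
  qed
  moreover have "Vector_Spaces.linear s1 s2 (\<lambda>x. F ((x, y) # Z))" "Vector_Spaces.linear s1 s2 (\<lambda>x. F ((y, x) # Z))"
    "F ((y, y) # Z) = 0" for y Z
    using slot[of "(y, y) # Z" 0] off[of "_ # Z"] by (cases "length Z = n"; simp add: linear_zero)+
  ultimately show ?R using off[of "[]"] by simp
next
  assume R: ?R
  then have off: "length X \<noteq> Suc n \<Longrightarrow> F X = 0" for X
    by (cases X) (auto simp: wedge_hom_def)
  show ?L unfolding wedge_hom_def
  proof (intro conjI allI impI, goal_cases)
    case (1 X) then show ?case by (simp add: off)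
  next
    case (2 X i y) then show ?case using R by (cases X; cases i) (auto simp: wedge_hom_def)
  next
    case (3 X i x) then show ?case using R by (cases X; cases i) (auto simp: wedge_hom_def)
  next
    case (4 X i x) then show ?case using R by (cases X; cases i) (auto simp: wedge_hom_def)
  qed
qed

lemma wedge_hom_off: "wedge_hom s1 s2 n F \<Longrightarrow> length X \<noteq> n \<Longrightarrow> F X = 0"
  by (simp add: wedge_hom_def)

lemma wedge_hom_zero: "wedge_hom s1 s2 n (\<lambda>X. 0)"
  by (simp add: wedge_hom_def linear_zero)

lemma wedge_hom_add:
  "wedge_hom s1 s2 n F \<Longrightarrow> wedge_hom s1 s2 n G \<Longrightarrow> wedge_hom s1 s2 n (\<lambda>X. F X + G X)"
  by (simp add: wedge_hom_def linear_compose_add)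

lemma wedge_hom_diff:
  "wedge_hom s1 s2 n F \<Longrightarrow> wedge_hom s1 s2 n G \<Longrightarrow> wedge_hom s1 s2 n (\<lambda>X. F X - G X)"
  by (simp add: wedge_hom_def linear_compose_sub)

lemma wedge_hom_scale: "wedge_hom s1 s2 n F \<Longrightarrow> wedge_hom s1 s2 n (\<lambda>X. s2 c (F X))"
  by (simp add: wedge_hom_def linear_compose_scale_right)

lemma wedge_hom_sum:
  "finite I \<Longrightarrow> (\<And>i. i \<in> I \<Longrightarrow> wedge_hom s1 s2 n (F i)) \<Longrightarrow> wedge_hom s1 s2 n (\<lambda>X. \<Sum>i\<in>I. F i X)"
  by (induction I rule: finite_induct) (simp_all add: wedge_hom_zero wedge_hom_add)

end

lemma wedge_hom_compose:
  assumes "wedge_hom s t n F" "Vector_Spaces.linear t r \<tau>"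
  shows "wedge_hom s r n (\<lambda>X. \<tau> (F X))"
proof -
  interpret \<tau>: Vector_Spaces.linear t r \<tau> by fact
  show ?thesis
    using assms unfolding wedge_hom_def by (auto simp: Vector_Spaces.linear_iff \<tau>.zero)
qed

lemma wedge_hom_precompose:
  assumes "wedge_hom s' r n f" and "Vector_Spaces.linear s s' \<phi>"
  shows "wedge_hom s r n (\<lambda>X. f (map (map_prod \<phi> \<phi>) X))"
  unfolding wedge_hom_def
proof (intro conjI allI impI, goal_cases)
  case (1 X) then show ?case using assms(1) by (simp add: wedge_hom_def)
next
  case (2 X i y)
  then have "Vector_Spaces.linear s' r (\<lambda>x. f ((map (map_prod \<phi> \<phi>) X)[i := (x, \<phi> y)]))"
    using assms(1) by (simp add: wedge_hom_def)
  from Vector_Spaces.linear_compose[OF assms(2) this] show ?case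
    by (simp add: map_update comp_def)
next
  case (3 X i x)
  then have "Vector_Spaces.linear s' r (\<lambda>y. f ((map (map_prod \<phi> \<phi>) X)[i := (\<phi> x, y)]))"
    using assms(1) by (simp add: wedge_hom_def)
  from Vector_Spaces.linear_compose[OF assms(2) this] show ?case
    by (simp add: map_update comp_def)
next
  case (4 X i x) then show ?case using assms(1) by (simp add: wedge_hom_def map_update)
qed

text \<open>
  The derivation of $(\wedge^2\mathfrak a)^{\otimes n}$ induced by an endomorphism \<open>A\<close>, transposed to functions: \<open>A\<close>
  is applied to each single entry in turn and the values are added. The recursion strips the first
  pair, which then becomes a parameter of the function.
\<close>
fun slot_action :: "('a \<Rightarrow> 'a) \<Rightarrow> (('a \<times> 'a) list \<Rightarrow> 'm) \<Rightarrow> ('a \<times> 'a) list \<Rightarrow> 'm::ab_group_add"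
  where
    "slot_action A F [] = 0"
  | "slot_action A F ((z, w) # Z) = F ((A z, w) # Z) + F ((z, A w) # Z) + slot_action A (\<lambda>Y. F ((z, w) # Y)) Z"

lemma slot_action_zero [simp]: "slot_action A (\<lambda>Z. 0) Z = 0"
  by (induction Z) auto

lemma slot_action_add: "slot_action A (\<lambda>Z. F Z + G Z) Z = slot_action A F Z + slot_action A G Z"
  by (induction Z arbitrary: F G) (auto simp: algebra_simps)

lemma slot_action_diff: "slot_action A (\<lambda>Z. F Z - G Z) Z = slot_action A F Z - slot_action A G Z"
  by (induction Z arbitrary: F G) (auto simp: algebra_simps)

lemma slot_action_compose:
  assumes "\<And>x y. \<tau> (x + y) = \<tau> x + \<tau> y" "\<tau> 0 = 0"
  shows "slot_action A (\<lambda>Z. \<tau> (F Z)) Z = \<tau> (slot_action A F Z)"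
  by (induction Z arbitrary: F) (auto simp: assms)

lemma slot_action_eq_sum:
  "slot_action A F Z = (\<Sum>i<length Z. F (Z[i := (A (fst (Z ! i)), snd (Z ! i))])
                             + F (Z[i := (fst (Z ! i), A (snd (Z ! i)))]))"
proof (induction Z arbitrary: F)
  case (Cons p Z)
  show ?case
    by (cases p) (simp add: Cons.IH sum.lessThan_Suc_shift del: sum.lessThan_Suc)
qed simp

text \<open>
  \<open>F\<close> and \<open>F'\<close> are different functions because stripping corresponding first pairs, as the recursion
  does, leaves an equivariant function in two different versions.
\<close>
lemma slot_action_natural:
  assumes "\<And>x. A' (\<sigma> x) = \<sigma> (A x)" "\<And>x y. \<tau> (x + y) = \<tau> x + \<tau> y" "\<tau> 0 = 0"
    and "\<And>Z. F' (map (map_prod \<sigma> \<sigma>) Z) = \<tau> (F Z)"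
  shows "slot_action A' F' (map (map_prod \<sigma> \<sigma>) Z) = \<tau> (slot_action A F Z)"
  using assms(4)
proof (induction Z arbitrary: F F')
  case Nil
  then show ?case by (simp add: assms)
next
  case (Cons p Z)
  obtain z w where p: "p = (z, w)" by fastforce
  have *: "F' (map_prod \<sigma> \<sigma> q # map (map_prod \<sigma> \<sigma>) Z) = \<tau> (F (q # Z))" for q Z
    using Cons.prems[of "q # Z"] by simp
  have IH: "slot_action A' (\<lambda>Y. F' ((\<sigma> z, \<sigma> w) # Y)) (map (map_prod \<sigma> \<sigma>) Z)
      = \<tau> (slot_action A (\<lambda>Y. F ((z, w) # Y)) Z)"
    by (rule Cons.IH) (use *[of "(z, w)"] in simp)
  show ?case
    using *[of "(A z, w)" Z] *[of "(z, A w)" Z] by (simp add: p assms(1,2) IH)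
qed

context vector_space_pair
begin

lemma wedge_hom_Cons: "wedge_hom s1 s2 (Suc n) F \<Longrightarrow> wedge_hom s1 s2 n (\<lambda>Z. F (p # Z))"
  unfolding wedge_hom_Suc by blast

lemma wedge_hom_head:
  assumes "wedge_hom s1 s2 (Suc n) F"
  shows "F ((x + x', y) # Z) = F ((x, y) # Z) + F ((x', y) # Z)"
    and "F ((x, y + y') # Z) = F ((x, y) # Z) + F ((x, y') # Z)"
    and "F ((s1 c x, y) # Z) = s2 c (F ((x, y) # Z))"
    and "F ((x, s1 c y) # Z) = s2 c (F ((x, y) # Z))"
    and "F ((x, x) # Z) = 0"
    and "F [] = 0"
  using assms by (simp_all add: wedge_hom_Suc linear_def_iff)

lemma wedge_hom_head_diff:
  assumes "wedge_hom s1 s2 (Suc n) F"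
  shows "F ((x - x', y) # Z) = F ((x, y) # Z) - F ((x', y) # Z)"
    and "F ((x, y - y') # Z) = F ((x, y) # Z) - F ((x, y') # Z)"
  using wedge_hom_head(1)[OF assms, of "x - x'" x' y Z]
  by (simp add: eq_diff_eq) (use wedge_hom_head(2)[OF assms, of x "y - y'" y' Z] in \<open>simp add: eq_diff_eq\<close>)

lemma wedge_hom_head_swap:
  assumes "wedge_hom s1 s2 (Suc n) F"
  shows "F ((x, y) # Z) + F ((y, x) # Z) = 0"
  using wedge_hom_head(5)[OF assms, of "x + y" Z] wedge_hom_head(5)[OF assms, of x Z]
    wedge_hom_head(5)[OF assms, of y Z]
  unfolding wedge_hom_head(1,2)[OF assms] by (simp add: add.commute)

lemma slot_action_scale: "slot_action A (\<lambda>Z. s2 c (F Z)) Z = s2 c (slot_action A F Z)"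
  by (rule slot_action_compose) (simp_all add: vs2.scale_right_distrib)

lemma wedge_hom_slot_action:
  assumes "Vector_Spaces.linear s1 s1 A"
  shows "wedge_hom s1 s2 n F \<Longrightarrow> wedge_hom s1 s2 n (slot_action A F)"
proof (induction n arbitrary: F)
  case 0
  have "slot_action A F Z = 0" for Z
    using 0 by (cases Z) (auto simp: wedge_hom_0)
  then show ?case by (simp add: wedge_hom_0)
next
  case (Suc n)
  have A: "A (x + y) = A x + A y" "A (s1 c x) = s1 c (A x)" for x y c
    using assms by (simp_all add: Vector_Spaces.linear_iff)
  note F = wedge_hom_head[OF Suc.prems]
  have "wedge_hom s1 s2 n (\<lambda>Z. slot_action A F (p # Z))" for p
    by (cases p) (use Suc.prems in \<open>simp add: wedge_hom_add wedge_hom_Cons Suc.IH\<close>)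
  then show ?case
    using wedge_hom_head_swap[OF Suc.prems]
    by (simp add: wedge_hom_Suc linear_def_iff F A slot_action_add slot_action_scale vs2.scale_right_distrib
        algebra_simps)
qed

lemma slot_action_operator_add:
  "wedge_hom s1 s2 n F \<Longrightarrow> slot_action (\<lambda>x. A x + B x) F Z = slot_action A F Z + slot_action B F Z"
proof (induction n arbitrary: F Z)
  case 0
  then show ?case by (cases Z) (auto simp: wedge_hom_0)
next
  case (Suc n)
  show ?case
    by (cases "(A, F, Z)" rule: slot_action.cases)
      (simp_all add: wedge_hom_head[OF Suc.prems] Suc.IH[OF wedge_hom_Cons[OF Suc.prems]] algebra_simps)
qed

lemma slot_action_operator_scale:
  "wedge_hom s1 s2 n F \<Longrightarrow> slot_action (\<lambda>x. s1 c (A x)) F Z = s2 c (slot_action A F Z)"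
proof (induction n arbitrary: F Z)
  case 0
  then show ?case by (cases Z) (auto simp: wedge_hom_0)
next
  case (Suc n)
  show ?case
    by (cases "(A, F, Z)" rule: slot_action.cases)
      (simp_all add: wedge_hom_head[OF Suc.prems] Suc.IH[OF wedge_hom_Cons[OF Suc.prems]]
        vs2.scale_right_distrib)
qed

lemma slot_action_operator_zero:
  assumes "wedge_hom s1 s2 n F"
  shows "slot_action (\<lambda>x. 0) F Z = 0"
  using slot_action_operator_scale[OF assms, of 0 "\<lambda>x. x"] by simp

text \<open>
  The order of composition is reversed because operators act on the arguments. The mixed terms, where
  \<open>A\<close> and \<open>B\<close> hit different entries, are symmetric and cancel.
\<close>
lemma slot_action_commutator:
  "wedge_hom s1 s2 n F \<Longrightarrow>
    slot_action A (slot_action B F) Z = slot_action B (slot_action A F) Z + slot_action (\<lambda>x. B (A x) - A (B x)) F Z"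
proof (induction n arbitrary: F Z)
  case 0
  have *: "slot_action A F = (\<lambda>Z. 0)" for A
  proof
    fix Z show "slot_action A F Z = 0" using 0 by (cases Z) (auto simp: wedge_hom_0)
  qed
  show ?case by (simp add: *)
next
  case (Suc n)
  show ?case
    by (cases "(A, F, Z)" rule: slot_action.cases)
      (simp_all add: wedge_hom_head_diff[OF Suc.prems] Suc.IH[OF wedge_hom_Cons[OF Suc.prems]]
        slot_action_add algebra_simps)
qed

lemma wedge_hom_drop_prefix:
  "wedge_hom s1 s2 (length X + n) F \<Longrightarrow> wedge_hom s1 s2 n (\<lambda>Y. F (X @ Y))"
proof (induction X arbitrary: F)
  case (Cons p X)
  then show ?case using Cons.IH[OF wedge_hom_Cons, of F p] by simp
qed simp

lemma wedge_hom_drop_suffix: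
  assumes "wedge_hom s1 s2 (n + length Y) F"
  shows "wedge_hom s1 s2 n (\<lambda>X. F (X @ Y))"
  unfolding wedge_hom_def
proof (intro conjI allI impI, goal_cases)
  case (1 X) then show ?case using assms by (simp add: wedge_hom_def)
next
  case (2 X i y) then show ?case
    using assms unfolding wedge_hom_def by (simp add: list_update_append1[symmetric])
next
  case (3 X i x) then show ?case
    using assms unfolding wedge_hom_def by (simp add: list_update_append1[symmetric])
next
  case (4 X i x) then show ?case
    using assms unfolding wedge_hom_def by (simp add: list_update_append1[symmetric])
qed

lemma wedge_hom_slot:
  assumes "wedge_hom s1 s2 n F"
  shows "Vector_Spaces.linear s1 s2 (\<lambda>x. F (X @ (x, y) # Y))"
    and "Vector_Spaces.linear s1 s2 (\<lambda>y. F (X @ (x, y) # Y))"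
    and "F (X @ (x, y) # Y) + F (X @ (y, x) # Y) = 0"
proof -
  have "Vector_Spaces.linear s1 s2 (\<lambda>x. F (X @ (x, y) # Y)) \<and>
    Vector_Spaces.linear s1 s2 (\<lambda>y. F (X @ (x, y) # Y)) \<and>
    F (X @ (x, y) # Y) + F (X @ (y, x) # Y) = 0"
  proof (cases "length X + Suc (length Y) = n")
    case True
    then have "wedge_hom s1 s2 (Suc (length Y)) (\<lambda>Y. F (X @ Y))"
      using wedge_hom_drop_prefix[of X "Suc (length Y)" F] assms by simp
    from this[unfolded wedge_hom_Suc] wedge_hom_head_swap[OF this] show ?thesis by simp
  next
    case False
    then show ?thesis by (simp add: wedge_hom_off[OF assms] linear_zero)
  qed
  then show "Vector_Spaces.linear s1 s2 (\<lambda>x. F (X @ (x, y) # Y))"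
    "Vector_Spaces.linear s1 s2 (\<lambda>y. F (X @ (x, y) # Y))"
    "F (X @ (x, y) # Y) + F (X @ (y, x) # Y) = 0" by simp_all
qed

text \<open>
  The extension by zero of a map on a mixed slot treats the pairs before that slot, the slot itself and
  the pairs after it in different ways; here the three parts are put together to one cochain.
\<close>
lemma wedge_hom_glue:
  assumes "\<And>e Q. wedge_hom s1 s2 a (\<lambda>P. H P e Q)" and "\<And>P e. wedge_hom s1 s2 b (H P e)"
    and "\<And>P y Q. Vector_Spaces.linear s1 s2 (\<lambda>x. H P (x, y) Q)"
    and "\<And>P x Q. Vector_Spaces.linear s1 s2 (\<lambda>y. H P (x, y) Q)"
    and "\<And>P x Q. H P (x, x) Q = 0"
  shows "wedge_hom s1 s2 (a + Suc b)
    (\<lambda>X. if length X = a + Suc b then H (take a X) (X ! a) (drop (Suc a) X) else 0)"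
  using assms
proof (induction a arbitrary: H)
  case 0
  have "wedge_hom s1 s2 b (\<lambda>Z. if length Z = b then H [] e Z else 0)" for e
  proof -
    have "(\<lambda>Z. if length Z = b then H [] e Z else 0) = H [] e"
      by (rule ext) (simp add: wedge_hom_off[OF 0(2)])
    then show ?thesis using 0(2) by simp
  qed
  moreover have "Vector_Spaces.linear s1 s2 (\<lambda>x. if length Z = b then H [] (x, y) Z else 0)"
    "Vector_Spaces.linear s1 s2 (\<lambda>x. if length Z = b then H [] (y, x) Z else 0)" for y Z
    using 0(3,4) by (cases "length Z = b"; simp add: linear_zero)+
  ultimately show ?case
    using 0(5) by (simp add: wedge_hom_Suc cong: if_cong)
next
  case (Suc a)
  have "wedge_hom s1 s2 (a + Suc b)
     (\<lambda>Z. if length Z = a + Suc b then H (e # take a Z) (Z ! a) (drop (Suc a) Z) else 0)" for e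
  proof (rule Suc.IH[of "\<lambda>P. H (e # P)"])
    show "wedge_hom s1 s2 a (\<lambda>P. H (e # P) e' Q)" for e' Q
      by (rule wedge_hom_Cons[OF Suc.prems(1)])
  qed (rule Suc.prems)+
  moreover have "Vector_Spaces.linear s1 s2 (\<lambda>x. if c then H ((x, y) # P) e Q else 0)"
      "Vector_Spaces.linear s1 s2 (\<lambda>x. if c then H ((y, x) # P) e Q else 0)" "H ((y, y) # P) e Q = 0"
    for c y P e Q
    using Suc.prems(1)[of e Q] by (cases c; simp add: wedge_hom_Suc linear_zero)+
  ultimately show ?case
    by (simp add: wedge_hom_Suc[of "Suc (a + b)"] cong: if_cong)
qed

end

section \<open>The Leibniz complex\<close>

text \<open>
  The operators \<open>t x y\<close> are derivations of \<open>t\<close>, so that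
  $(x\wedge y)\circ(z\wedge w)=t(x,y,z)\wedge w+z\wedge t(x,y,w)$ is a Leibniz product on
  $\wedge^2\mathfrak a$. As this is a sum of two decomposable elements, the identities below are stated for
  functions of two vectors and contain two terms for each occurrence of $\circ$. The map \<open>l\<close> is the left
  action. The map \<open>r\<close> is the coboundary in degree zero, which is the negative of the usual right
  action. Most conditions are imposed on a subspace \<open>M\<close> only, because in the application the actions are linear in
  \<open>x\<close> and \<open>y\<close> only on linear maps, whereas the ambient type contains all functions.
\<close>
locale leibniz_coefficients = vector_space_pair s sm
  for s :: "'k::field \<Rightarrow> 'a::ab_group_add \<Rightarrow> 'a" and sm :: "'k \<Rightarrow> 'm::ab_group_add \<Rightarrow> 'm" +
  fixes t :: "'a \<Rightarrow> 'a \<Rightarrow> 'a \<Rightarrow> 'a"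
    and l r :: "'a \<Rightarrow> 'a \<Rightarrow> 'm \<Rightarrow> 'm"
    and M :: "'m set"
  assumes t_linear1: "Vector_Spaces.linear s s (\<lambda>x. t x y z)"
    and t_linear2: "Vector_Spaces.linear s s (\<lambda>y. t x y z)"
    and t_linear3: "Vector_Spaces.linear s s (t x y)"
    and t_alt: "t x x z = 0"
    and t_derivation: "t x y (t z w u) = t (t x y z) w u + t z (t x y w) u + t z w (t x y u)"
    and M_subspace: "vs2.subspace M"
    and l_closed: "m \<in> M \<Longrightarrow> l x y m \<in> M"
    and r_closed: "m \<in> M \<Longrightarrow> r x y m \<in> M"
    and l_linear1: "m \<in> M \<Longrightarrow> Vector_Spaces.linear s sm (\<lambda>x. l x y m)"
    and l_linear2: "m \<in> M \<Longrightarrow> Vector_Spaces.linear s sm (\<lambda>y. l x y m)"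
    and l_linear3: "Vector_Spaces.linear sm sm (l x y)"
    and l_alt: "m \<in> M \<Longrightarrow> l x x m = 0"
    and r_linear1: "m \<in> M \<Longrightarrow> Vector_Spaces.linear s sm (\<lambda>x. r x y m)"
    and r_linear2: "m \<in> M \<Longrightarrow> Vector_Spaces.linear s sm (\<lambda>y. r x y m)"
    and r_linear3: "Vector_Spaces.linear sm sm (r x y)"
    and r_alt: "m \<in> M \<Longrightarrow> r x x m = 0"
    and l_l: "m \<in> M \<Longrightarrow> l x y (l z w m) = l z w (l x y m) + (l (t x y z) w m + l z (t x y w) m)"
    and l_r: "m \<in> M \<Longrightarrow> l x y (r z w m) = r z w (l x y m) + (r (t x y z) w m + r z (t x y w) m)"
    and r_l: "m \<in> M \<Longrightarrow> r z w (l x y m) = r z w (r x y m)"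
begin

lemma l_apply [simp]:
  "l x y 0 = 0" "l x y (m + m') = l x y m + l x y m'" "l x y (m - m') = l x y m - l x y m'"
  "l x y (sm c m) = sm c (l x y m)"
proof -
  interpret Vector_Spaces.linear sm sm "l x y" by (rule l_linear3)
  show "l x y 0 = 0" "l x y (m + m') = l x y m + l x y m'" "l x y (m - m') = l x y m - l x y m'"
  "l x y (sm c m) = sm c (l x y m)" by (simp_all add: add diff scale zero)
qed

lemma r_apply [simp]:
  "r x y 0 = 0" "r x y (m + m') = r x y m + r x y m'" "r x y (m - m') = r x y m - r x y m'"
  "r x y (sm c m) = sm c (r x y m)"
proof -
  interpret Vector_Spaces.linear sm sm "r x y" by (rule r_linear3)
  show "r x y 0 = 0" "r x y (m + m') = r x y m + r x y m'" "r x y (m - m') = r x y m - r x y m'"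
  "r x y (sm c m) = sm c (r x y m)" by (simp_all add: add diff scale zero)
qed

text \<open>The operator $L_X$ of the Cartan calculus for $X=x\wedge y$.\<close>
definition lie_derivative :: "'a \<Rightarrow> 'a \<Rightarrow> (('a \<times> 'a) list \<Rightarrow> 'm) \<Rightarrow> ('a \<times> 'a) list \<Rightarrow> 'm"
  where "lie_derivative x y F Z = l x y (F Z) - slot_action (t x y) F Z"

text \<open>
  Cartan's formula $\iota_X d=L_X-d\,\iota_X$ read as a definition. It is uniform in the degree: the value on
  a list of length \<open>n + 1\<close> only involves values on lists of length \<open>n\<close>.
\<close>
fun coboundary :: "(('a \<times> 'a) list \<Rightarrow> 'm) \<Rightarrow> ('a \<times> 'a) list \<Rightarrow> 'm"
  where
    "coboundary F [] = 0"
  | "coboundary F ((x, y) # Z) =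
      (if Z = [] then r x y (F []) else lie_derivative x y F Z - coboundary (\<lambda>Y. F ((x, y) # Y)) Z)"

lemma lie_derivative_zero [simp]: "lie_derivative x y (\<lambda>Z. 0) Z = 0"
  by (simp add: lie_derivative_def)

lemma lie_derivative_add: "lie_derivative x y (\<lambda>Z. F Z + G Z) Z = lie_derivative x y F Z + lie_derivative x y G Z"
  by (simp add: lie_derivative_def slot_action_add)

lemma lie_derivative_diff: "lie_derivative x y (\<lambda>Z. F Z - G Z) Z = lie_derivative x y F Z - lie_derivative x y G Z"
  by (simp add: lie_derivative_def slot_action_diff)

lemma lie_derivative_scale: "lie_derivative x y (\<lambda>Z. sm c (F Z)) Z = sm c (lie_derivative x y F Z)"
  by (simp add: lie_derivative_def slot_action_scale vs2.scale_right_diff_distrib)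

lemma coboundary_zero [simp]: "coboundary (\<lambda>Z. 0) Z = 0"
  by (induction Z) auto

lemma coboundary_add: "coboundary (\<lambda>Z. F Z + G Z) Z = coboundary F Z + coboundary G Z"
  by (induction Z arbitrary: F G) (auto simp: lie_derivative_add algebra_simps)

lemma coboundary_diff: "coboundary (\<lambda>Z. F Z - G Z) Z = coboundary F Z - coboundary G Z"
  by (induction Z arbitrary: F G) (auto simp: lie_derivative_diff algebra_simps)

lemma coboundary_scale: "coboundary (\<lambda>Z. sm c (F Z)) Z = sm c (coboundary F Z)"
  by (induction Z arbitrary: F) (auto simp: lie_derivative_scale vs2.scale_right_diff_distrib)

text \<open>
  For cochains of a fixed degree the case distinction in the recursion is spurious
  (\<open>coboundary_Cons\<close>, \<open>coboundary_degree0\<close>), so it should not be unfolded by default.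
\<close>
declare coboundary.simps(2) [simp del]

definition cochain :: "nat \<Rightarrow> (('a \<times> 'a) list \<Rightarrow> 'm) \<Rightarrow> bool"
  where "cochain n F \<longleftrightarrow> wedge_hom s sm n F \<and> range F \<subseteq> M"

lemma cochain_in: "cochain n F \<Longrightarrow> F Z \<in> M"
  by (auto simp: cochain_def)

lemma cochain_Cons: "cochain (Suc n) F \<Longrightarrow> cochain n (\<lambda>Z. F (p # Z))"
  by (auto simp: cochain_def wedge_hom_Cons)

lemma cochain_Nil: "cochain (Suc n) F \<Longrightarrow> F [] = 0"
  by (simp add: cochain_def wedge_hom_def)

lemma cochain_off: "cochain n F \<Longrightarrow> length Z \<noteq> n \<Longrightarrow> F Z = 0"
  by (simp add: cochain_def wedge_hom_def)

lemma slot_action_closed: "range F \<subseteq> M \<Longrightarrow> slot_action A F Z \<in> M"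
proof (induction Z arbitrary: F)
  case Nil
  then show ?case by (simp add: vs2.subspace_0[OF M_subspace])
next
  case (Cons p Z)
  have "range (\<lambda>Y. F (p # Y)) \<subseteq> M" using Cons.prems by auto
  moreover have "F Z \<in> M" for Z using Cons.prems by auto
  ultimately show ?case
    by (cases p) (auto intro!: vs2.subspace_add[OF M_subspace] Cons.IH)
qed

lemma cochain_lie_derivative:
  assumes "cochain n F"
  shows "cochain n (lie_derivative x y F)"
proof -
  have F: "wedge_hom s sm n F" "range F \<subseteq> M" using assms by (auto simp: cochain_def)
  have "lie_derivative x y F Z \<in> M" for Z
    unfolding lie_derivative_def
    by (intro vs2.subspace_diff[OF M_subspace] l_closed slot_action_closed F cochain_in[OF assms])
  moreover have "wedge_hom s sm n (\<lambda>Z. l x y (F Z) - slot_action (t x y) F Z)"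
    by (intro wedge_hom_diff wedge_hom_slot_action t_linear3 F wedge_hom_compose[OF F(1) l_linear3])
  ultimately show ?thesis
    unfolding cochain_def lie_derivative_def by auto
qed

lemma cochain_diff: "cochain n F \<Longrightarrow> cochain n G \<Longrightarrow> cochain n (\<lambda>Z. F Z - G Z)"
  unfolding cochain_def by (simp add: wedge_hom_diff image_subset_iff vs2.subspace_diff[OF M_subspace])

text \<open>
  The left action and the operators \<open>t x y\<close> both depend linearly and alternatingly on \<open>x\<close> and \<open>y\<close>;
  for the latter the linearity of \<open>F\<close> in each entry is used.
\<close>
lemma lie_derivative_operator_linear:
  assumes "cochain n F"
  shows "lie_derivative (x + x') y F Z = lie_derivative x y F Z + lie_derivative x' y F Z"
    and "lie_derivative y (x + x') F Z = lie_derivative y x F Z + lie_derivative y x' F Z"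
    and "lie_derivative (s c x) y F Z = sm c (lie_derivative x y F Z)"
    and "lie_derivative y (s c x) F Z = sm c (lie_derivative y x F Z)"
    and "lie_derivative x x F Z = 0"
proof -
  have F: "wedge_hom s sm n F" "F Z \<in> M" using assms by (auto simp: cochain_def)
  note t = t_linear1[unfolded Vector_Spaces.linear_iff] t_linear2[unfolded Vector_Spaces.linear_iff]
  have t': "t (x + x') y = (\<lambda>z. t x y z + t x' y z)" "t y (x + x') = (\<lambda>z. t y x z + t y x' z)"
    "t (s c x) y = (\<lambda>z. s c (t x y z))" "t y (s c x) = (\<lambda>z. s c (t y x z))" "t x x = (\<lambda>z. 0)"
    for x x' y c using t by (auto simp: t_alt)
  note l = l_linear1[OF F(2), unfolded linear_def_iff] l_linear2[OF F(2), unfolded linear_def_iff]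
  show "lie_derivative (x + x') y F Z = lie_derivative x y F Z + lie_derivative x' y F Z"
    "lie_derivative y (x + x') F Z = lie_derivative y x F Z + lie_derivative y x' F Z"
    "lie_derivative (s c x) y F Z = sm c (lie_derivative x y F Z)"
    "lie_derivative y (s c x) F Z = sm c (lie_derivative y x F Z)"
    "lie_derivative x x F Z = 0"
    using l by (simp_all add: lie_derivative_def t' slot_action_operator_add[OF F(1)] slot_action_operator_scale[OF F(1)]
        slot_action_operator_zero[OF F(1)] l_alt[OF F(2)] vs2.scale_right_diff_distrib)
qed

text \<open>
  $[L_X,L_Y]=L_{X\circ Y}$: on values this is \<open>l_l\<close>, on arguments it is the derivation property of \<open>t\<close>
  combined with \<open>slot_action_commutator\<close>.
\<close>
lemma lie_derivative_commutator:
  assumes "cochain n F"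
  shows "lie_derivative x y (lie_derivative z w F) Z = lie_derivative z w (lie_derivative x y F) Z + (lie_derivative (t x y z) w F Z + lie_derivative z (t x y w) F Z)"
proof -
  have F: "wedge_hom s sm n F" "F Z \<in> M" using assms by (auto simp: cochain_def)
  have sl: "slot_action A (\<lambda>Z. l x y (F Z)) Z = l x y (slot_action A F Z)" for A x y
    by (rule slot_action_compose) simp_all
  have *: "lie_derivative x y (lie_derivative z w F) Z = l x y (l z w (F Z)) - l x y (slot_action (t z w) F Z)
      - l z w (slot_action (t x y) F Z) + slot_action (t x y) (slot_action (t z w) F) Z" for x y z w
    unfolding lie_derivative_def[of x y] lie_derivative_def[of z w, abs_def] by (simp add: slot_action_diff sl algebra_simps)
  have "(\<lambda>u. t x y (t z w u) - t z w (t x y u)) = (\<lambda>u. t (t x y z) w u + t z (t x y w) u)"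
    by (simp add: t_derivation[of x y])
  then have "slot_action (t z w) (slot_action (t x y) F) Z = slot_action (t x y) (slot_action (t z w) F) Z
      + (slot_action (t (t x y z) w) F Z + slot_action (t z (t x y w)) F Z)"
    using slot_action_commutator[OF F(1), of "t z w" "t x y" Z] slot_action_operator_add[OF F(1), of "t (t x y z) w" "t z (t x y w)" Z]
    by simp
  then show ?thesis
    unfolding * unfolding lie_derivative_def l_l[OF F(2), of x y z w] by (simp add: algebra_simps)
qed

lemma lie_derivative_Cons:
  "lie_derivative x y F ((z, w) # Z) = lie_derivative x y (\<lambda>Y. F ((z, w) # Y)) Z - F ((t x y z, w) # Z) - F ((z, t x y w) # Z)"
  by (simp add: lie_derivative_def algebra_simps)

text \<open>If \<open>F\<close> vanishes on the empty list, both alternatives of the recursion agree on a singleton.\<close>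
lemma coboundary_Cons:
  assumes "F [] = 0"
  shows "coboundary F ((x, y) # Z) = lie_derivative x y F Z - coboundary (\<lambda>Y. F ((x, y) # Y)) Z"
  by (cases Z) (simp_all add: assms lie_derivative_def coboundary.simps)

lemma coboundary_degree0:
  assumes "cochain 0 F"
  shows "coboundary F ((x, y) # Z) = (if Z = [] then r x y (F []) else 0)"
proof -
  have "(\<lambda>Y. F ((x, y) # Y)) = (\<lambda>Y. 0)" using cochain_off[OF assms] by auto
  then show ?thesis using cochain_off[OF cochain_lie_derivative[OF assms]] by (simp add: coboundary.simps)
qed

lemma coboundary_off: "cochain n F \<Longrightarrow> length Z \<noteq> Suc n \<Longrightarrow> coboundary F Z = 0"
proof (induction n arbitrary: F Z)
  case 0
  then show ?case by (cases "(F, Z)" rule: coboundary.cases) (auto simp: coboundary_degree0)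
next
  case (Suc n)
  then show ?case
    by (cases "(F, Z)" rule: coboundary.cases)
      (auto simp: coboundary_Cons cochain_Nil cochain_off[OF cochain_lie_derivative] cochain_Cons)
qed

lemma cochain_coboundary: "cochain n F \<Longrightarrow> cochain (Suc n) (coboundary F)"
proof (induction n arbitrary: F)
  case 0
  have m: "F [] \<in> M" using 0 by (rule cochain_in)
  have "coboundary F Z \<in> M" for Z
    by (cases "(F, Z)" rule: coboundary.cases)
      (auto simp: coboundary_degree0[OF 0] r_closed m vs2.subspace_0[OF M_subspace])
  moreover have "wedge_hom s sm (Suc 0) (coboundary F)"
    using r_linear1[OF m, unfolded linear_def_iff] r_linear2[OF m, unfolded linear_def_iff]
    by (auto simp: linear_def_iff wedge_hom_Suc wedge_hom_0 coboundary_degree0[OF 0] r_alt m linear_zero)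
  ultimately show ?case by (auto simp: cochain_def)
next
  case (Suc n)
  note Cons = coboundary_Cons[of F, OF cochain_Nil[OF Suc.prems]]
  have F: "wedge_hom s sm (Suc n) F" using Suc.prems by (simp add: cochain_def)
  have co: "cochain (Suc n) (\<lambda>Z. coboundary F ((x, y) # Z))" for x y
    unfolding Cons by (intro cochain_diff cochain_lie_derivative Suc.IH cochain_Cons Suc.prems)
  have "coboundary F Z \<in> M" for Z
    using co[THEN cochain_in] by (cases "(F, Z)" rule: coboundary.cases) (auto simp: vs2.subspace_0[OF M_subspace])
  moreover have "wedge_hom s sm (Suc (Suc n)) (coboundary F)"
    unfolding wedge_hom_Suc[of "Suc n"] linear_def_iff
    using co[unfolded cochain_def]
    by (auto simp: Cons lie_derivative_operator_linear[OF Suc.prems] wedge_hom_head[OF F] coboundary_add coboundary_scale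
        vs2.scale_right_diff_distrib algebra_simps)
  ultimately show ?case by (auto simp: cochain_def)
qed

text \<open>
  In degree zero $[L_X,d]=0$ is the identity \<open>l_r\<close>. In positive degree apply $\iota_Y$ and use
  $\iota_Y L_X=L_X\iota_Y-\iota_{X\circ Y}$ (\<open>lie_derivative_Cons\<close>) and Cartan's formula: what is left is
  $[L_X,L_Y]-L_{X\circ Y}=0$ and $[L_X,d]\,\iota_Y F$, which vanishes by induction.
\<close>
lemma coboundary_lie_derivative: "cochain n F \<Longrightarrow> coboundary (lie_derivative x y F) Z = lie_derivative x y (coboundary F) Z"
proof (induction n arbitrary: F Z)
  case 0
  note d1 = coboundary_degree0[OF cochain_lie_derivative[OF 0]] coboundary_degree0[OF 0]
  show ?case
  proof (cases "length Z = 1")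
    case True
    then obtain z w where Z: "Z = [(z, w)]" by (cases Z) auto
    show ?thesis
      unfolding Z d1 by (simp add: d1 lie_derivative_def l_r[OF cochain_in[OF 0]])
  next
    case False
    then show ?thesis
      using coboundary_off[OF cochain_lie_derivative[OF 0], of Z] cochain_off[OF cochain_lie_derivative[OF cochain_coboundary[OF 0]], of Z] by simp
  qed
next
  case (Suc n)
  note Fd = cochain_coboundary[OF Suc.prems] and F0 = cochain_Nil[OF Suc.prems]
  show ?case
  proof (cases "(F, Z)" rule: coboundary.cases)
    case (1 F)
    then show ?thesis using cochain_Nil[OF cochain_lie_derivative[OF Fd]] by simp
  next
    case (2 F' z w Z')
    then have Z: "Z = (z, w) # Z'" by simp
    let ?i = "\<lambda>Y. F ((z, w) # Y)"
    have i: "(\<lambda>Y. lie_derivative x y F ((z, w) # Y)) =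
        (\<lambda>Y. lie_derivative x y ?i Y - F ((t x y z, w) # Y) - F ((z, t x y w) # Y))"
      by (simp add: lie_derivative_Cons)
    have "coboundary (lie_derivative x y F) Z = lie_derivative z w (lie_derivative x y F) Z'
        - (lie_derivative x y (coboundary ?i) Z' - coboundary (\<lambda>Y. F ((t x y z, w) # Y)) Z' - coboundary (\<lambda>Y. F ((z, t x y w) # Y)) Z')"
      unfolding Z coboundary_Cons[of "lie_derivative x y F", OF cochain_Nil[OF cochain_lie_derivative[OF Suc.prems]]] i coboundary_diff
        Suc.IH[OF cochain_Cons[OF Suc.prems]] ..
    also have "\<dots> = lie_derivative x y (coboundary F) Z"
      unfolding Z lie_derivative_Cons coboundary_Cons[of F, OF F0] lie_derivative_diff lie_derivative_commutator[OF Suc.prems, of x y z w]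
      by (simp add: algebra_simps)
    finally show ?thesis .
  qed
qed

text \<open>
  $\iota_X d\,d=L_X d-d\,\iota_X d=L_X d-d\,L_X+d\,d\,\iota_X$; the first two terms cancel and the last one is zero by
  induction. In degree zero the same computation gives $r(Y)\,(l(X)-r(X))$, which is where \<open>r_l\<close> is
  needed.
\<close>
theorem coboundary_coboundary: "cochain n F \<Longrightarrow> coboundary (coboundary F) Z = 0"
proof (induction n arbitrary: F Z)
  case 0
  note d0 = coboundary_degree0[OF 0]
  show ?case
  proof (cases "length Z = 2")
    case True
    then obtain x y z w where Z: "Z = [(x, y), (z, w)]"
      by (auto simp: length_Suc_conv numeral_2_eq_2)
    have "coboundary (\<lambda>Y. coboundary F ((x, y) # Y)) [(z, w)] = r z w (r x y (F []))"
      by (simp add: d0 coboundary.simps)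
    moreover have "lie_derivative x y (coboundary F) [(z, w)] = r z w (l x y (F []))"
      by (simp add: d0 lie_derivative_def l_r[OF cochain_in[OF 0]])
    ultimately show ?thesis
      unfolding Z coboundary_Cons[of "coboundary F", simplified] using r_l[OF cochain_in[OF 0]] by simp
  next
    case False
    then show ?thesis using coboundary_off[OF cochain_coboundary[OF 0], of Z] by simp
  qed
next
  case (Suc n)
  show ?case
  proof (cases "(F, Z)" rule: coboundary.cases)
    case (2 F' x y Z')
    then have Z: "Z = (x, y) # Z'" by simp
    have "coboundary (\<lambda>Y. coboundary F ((x, y) # Y)) Z' = lie_derivative x y (coboundary F) Z'"
      unfolding coboundary_Cons[of F, OF cochain_Nil[OF Suc.prems]] coboundary_diff
        Suc.IH[OF cochain_Cons[OF Suc.prems]] coboundary_lie_derivative[OF Suc.prems] by simp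
    then show ?thesis
      unfolding Z by (subst coboundary_Cons) simp_all
  qed simp
qed

lemma coboundary_natural:
  assumes t: "\<And>x y z. t (\<sigma> x) (\<sigma> y) (\<sigma> z) = \<sigma> (t x y z)"
    and \<tau>: "\<And>m m'. \<tau> (m + m') = \<tau> m + \<tau> m'"
    and l: "\<And>x y m. l (\<sigma> x) (\<sigma> y) (\<tau> m) = \<tau> (l x y m)"
    and r: "\<And>x y m. r (\<sigma> x) (\<sigma> y) (\<tau> m) = \<tau> (r x y m)"
  shows "(\<And>Z. F' (map (map_prod \<sigma> \<sigma>) Z) = \<tau> (F Z)) \<Longrightarrow>
    coboundary F' (map (map_prod \<sigma> \<sigma>) Z) = \<tau> (coboundary F Z)"
proof (induction Z arbitrary: F F')
  case Nil
  show ?case using \<tau>[of 0 0] by simp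
next
  case (Cons p Z)
  interpret \<tau>: additive \<tau> by unfold_locales (rule \<tau>)
  obtain x y where p: "p = (x, y)" by fastforce
  have "coboundary (\<lambda>Y. F' ((\<sigma> x, \<sigma> y) # Y)) (map (map_prod \<sigma> \<sigma>) Z) = \<tau> (coboundary (\<lambda>Y. F ((x, y) # Y)) Z)"
    by (rule Cons.IH) (use Cons.prems[of "(x, y) # _"] in simp)
  moreover have "slot_action (t (\<sigma> x) (\<sigma> y)) F' (map (map_prod \<sigma> \<sigma>) Z) = \<tau> (slot_action (t x y) F Z)"
    by (rule slot_action_natural) (simp_all add: t \<tau> \<tau>.zero Cons.prems)
  ultimately show ?case
    using Cons.prems[of "[]"] by (simp add: p coboundary.simps lie_derivative_def Cons.prems l r \<tau>.diff)
qed

end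

lemma sum_from_1_Suc:
  "(\<Sum>k = 1..Suc n. a k) = a 1 + (\<Sum>k = 1..n. a (Suc k) :: 'w::comm_monoid_add)"
  by (simp add: sum.atLeast_Suc_atMost sum.atLeast_Suc_atMost_Suc_shift del: sum.cl_ivl_Suc)

lemma sum_from_1_less_Suc:
  "(\<Sum>k = 1..<Suc (Suc n). a k) = a 1 + (\<Sum>k = 1..<Suc n. a (Suc k) :: 'w::comm_monoid_add)"
  by (simp add: sum.atLeast_Suc_lessThan sum.atLeast_Suc_lessThan_Suc_shift del: sum.op_ivl_Suc)

lemma omit_Cons: "omit (Suc (Suc k)) (p # X) = p # omit (Suc k) X" "omit (Suc 0) (p # X) = X"
  by (simp_all add: omit_def)

lemma circ_eval_Cons:
  "circ_eval t (Suc (Suc k)) (Suc (Suc j)) F (p # X) = circ_eval t (Suc k) (Suc j) (\<lambda>Y. F (p # Y)) X"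
  by (simp add: circ_eval_def omit_Cons)

text \<open>The terms of the double sum in which the first pair acts on one of the others.\<close>
lemma sum_circ_eval_Cons:
  assumes "length X = Suc n"
  shows "(\<Sum>j = 1..Suc n. circ_eval t 1 (Suc j) F ((x, y) # X)) = slot_action (t x y) F X"
proof -
  have "circ_eval t 1 (Suc (Suc i)) F ((x, y) # X)
      = F (X[i := (t x y (fst (X ! i)), snd (X ! i))]) + F (X[i := (fst (X ! i), t x y (snd (X ! i)))])" for i
    by (simp add: circ_eval_def omit_Cons split: prod.split)
  moreover have "(\<Sum>j = 1..Suc n. circ_eval t 1 (Suc j) F ((x, y) # X))
      = (\<Sum>i<Suc n. circ_eval t 1 (Suc (Suc i)) F ((x, y) # X))"
    by (rule sum.reindex_bij_witness[of _ Suc "\<lambda>j. j - 1"]) auto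
  ultimately show ?thesis by (simp only: slot_action_eq_sum assms)
qed

context leibniz_coefficients
begin

text \<open>
  The usual signed sums solve Cartan's recursion: the summands with \<open>k = 1\<close> form the Lie
  derivative along the first pair, and shifting \<open>k\<close> by one in the others accounts for the sign in front of
  $d\,\iota_X$. There is no left action of the last pair; its place is taken by \<open>r\<close>.
\<close>
lemma coboundary_eq_sum:
  assumes "length X = Suc n"
  shows "coboundary F X = signed n (r (fst (X ! n)) (snd (X ! n)) (F (take n X)))
    + (\<Sum>k = 1..n. signed (k + 1) (l (fst (X ! (k - 1))) (snd (X ! (k - 1))) (F (omit k X))))
    + (\<Sum>j = 1..n + 1. \<Sum>k = 1..<j. signed k (circ_eval t k j F X))"
  using assms
proof (induction n arbitrary: F X)
  case 0
  then obtain x y where "X = [(x, y)]" by (cases X) auto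
  then show ?case by (simp add: coboundary.simps)
next
  case (Suc n)
  obtain x y Z where X: "X = (x, y) # Z" and Z: "length Z = Suc n" using Suc.prems by (cases X) auto
  have "Z \<noteq> []" using Z by auto
  let ?a = "\<lambda>k. signed (k + 1) (l (fst (X ! (k - 1))) (snd (X ! (k - 1))) (F (omit k X)))"
  let ?i = "\<lambda>Y. F ((x, y) # Y)"
  have a: "(\<Sum>k = 1..Suc n. ?a k) = l x y (F Z)
      - (\<Sum>k = 1..n. signed (k + 1) (l (fst (Z ! (k - 1))) (snd (Z ! (k - 1))) (?i (omit k Z))))"
  proof -
    have "?a (Suc k) = - signed (k + 1) (l (fst (Z ! (k - 1))) (snd (Z ! (k - 1))) (?i (omit k Z)))"
      if "k \<in> {1..n}" for k
      using that by (cases k) (simp_all add: X omit_Cons)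
    moreover have "?a 1 = l x y (F Z)" by (simp add: X omit_Cons)
    ultimately show ?thesis
      unfolding sum_from_1_Suc[of ?a n] by (simp add: sum_negf)
  qed
  have inner: "(\<Sum>k = 1..<Suc j. signed k (circ_eval t k (Suc j) F X))
      = - circ_eval t 1 (Suc j) F X - (\<Sum>k = 1..<j. signed k (circ_eval t k j ?i Z))"
    if j1: "j \<in> {1..n + 1}" for j
  proof -
    obtain j' where j: "j = Suc j'" using j1 by (cases j) auto
    have "signed (Suc k) (circ_eval t (Suc k) (Suc j) F X) = - signed k (circ_eval t k j ?i Z)"
      if "k \<in> {1..<j}" for k
      using that by (cases k) (simp_all add: X j circ_eval_Cons)
    then show ?thesis
      unfolding j sum_from_1_less_Suc by (simp add: sum_negf j)
  qed
  have "(\<Sum>j = 1..Suc n + 1. \<Sum>k = 1..<j. signed k (circ_eval t k j F X))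
      = (\<Sum>j = 1..n + 1. \<Sum>k = 1..<Suc j. signed k (circ_eval t k (Suc j) F X))"
    using sum_from_1_Suc[of "\<lambda>j. \<Sum>k = 1..<j. signed k (circ_eval t k j F X)" "Suc n"]
    by simp
  also have "\<dots> = (\<Sum>j = 1..n + 1. - circ_eval t 1 (Suc j) F X
      - (\<Sum>k = 1..<j. signed k (circ_eval t k j ?i Z)))"
    by (rule sum.cong[OF refl inner])
  also have "\<dots> = - slot_action (t x y) F Z
      - (\<Sum>j = 1..n + 1. \<Sum>k = 1..<j. signed k (circ_eval t k j ?i Z))"
    unfolding sum_circ_eval_Cons[OF Z, symmetric]
    by (simp add: sum_subtractf sum_negf X del: sum.cl_ivl_Suc)
  finally have b: "(\<Sum>j = 1..Suc n + 1. \<Sum>k = 1..<j. signed k (circ_eval t k j F X)) = \<dots>" .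
  have c: "signed (Suc n) (r (fst (X ! Suc n)) (snd (X ! Suc n)) (F (take (Suc n) X)))
      = - signed n (r (fst (Z ! n)) (snd (Z ! n)) (?i (take n Z)))"
    by (simp add: X)
  show ?case
    unfolding a b c using Suc.IH[OF Z, of ?i] \<open>Z \<noteq> []\<close>
    by (simp add: X coboundary.simps lie_derivative_def algebra_simps)
qed

end

section \<open>The Yamaguti complex as a Leibniz complex\<close>

context lie_yamaguti_algebra
begin

lemma br_tr_linear [simp]:
  "br (a + a') b = br a b + br a' b" "br a (b + b') = br a b + br a b'"
  "tr (a + a') b c = tr a b c + tr a' b c" "tr a (b + b') c = tr a b c + tr a b' c"
  "tr a b (c + c') = tr a b c + tr a b c'"
  "br (sg k a) b = sg k (br a b)" "br a (sg k b) = sg k (br a b)"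
  "tr (sg k a) b c = sg k (tr a b c)" "tr a (sg k b) c = sg k (tr a b c)"
  "tr a b (sg k c) = sg k (tr a b c)"
  using br_linear1 br_linear2 tr_linear1 tr_linear2 tr_linear3
  by (simp_all add: Vector_Spaces.linear_iff)

lemma br_tr_diff [simp]:
  "br (a - a') b = br a b - br a' b" "br a (b - b') = br a b - br a b'"
  "tr (a - a') b c = tr a b c - tr a' b c" "tr a (b - b') c = tr a b c - tr a b' c"
  "tr a b (c - c') = tr a b c - tr a b c'"
  by (simp_all add: eq_diff_eq br_tr_linear(1-5)[symmetric] del: br_tr_linear)

lemma br_tr_zero [simp]:
  "br 0 b = 0" "br a 0 = 0" "tr 0 b c = 0" "tr a 0 c = 0" "tr a b 0 = 0"
  using br_tr_diff(1)[of 0 0] br_tr_diff(2)[of _ 0 0] br_tr_diff(3)[of 0 0] br_tr_diff(4)[of _ 0 0]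
    br_tr_diff(5)[of _ _ 0 0] by simp_all

lemma br_skew: "br y x = - br x y"
  using br_alt[of "x + y"] unfolding br_tr_linear by (simp add: br_alt eq_neg_iff_add_eq_0 add.commute)

lemma tr_skew: "tr y x z = - tr x y z"
  using tr_alt[of "x + y" z] unfolding br_tr_linear by (simp add: tr_alt eq_neg_iff_add_eq_0 add.commute)

end

context ly_representation
begin

abbreviation "D \<equiv> rep_D br \<rho> \<mu>"

lemma rho_mu_linear [simp]:
  "\<rho> (a + a') v = \<rho> a v + \<rho> a' v" "\<rho> a (v + v') = \<rho> a v + \<rho> a v'"
  "\<mu> (a + a') b v = \<mu> a b v + \<mu> a' b v" "\<mu> a (b + b') v = \<mu> a b v + \<mu> a b' v"
  "\<mu> a b (v + v') = \<mu> a b v + \<mu> a b v'"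
  "\<rho> (sg k a) v = sv k (\<rho> a v)" "\<rho> a (sv k v) = sv k (\<rho> a v)"
  "\<mu> (sg k a) b v = sv k (\<mu> a b v)" "\<mu> a (sg k b) v = sv k (\<mu> a b v)"
  "\<mu> a b (sv k v) = sv k (\<mu> a b v)"
  using rho_linear1 rho_linear2 mu_linear1 mu_linear2 mu_linear3
  by (simp_all add: Vector_Spaces.linear_iff)

lemma rho_mu_diff [simp]:
  "\<rho> (a - a') v = \<rho> a v - \<rho> a' v" "\<rho> a (v - v') = \<rho> a v - \<rho> a v'"
  "\<mu> (a - a') b v = \<mu> a b v - \<mu> a' b v" "\<mu> a (b - b') v = \<mu> a b v - \<mu> a b' v"
  "\<mu> a b (v - v') = \<mu> a b v - \<mu> a b v'"
  by (simp_all add: eq_diff_eq rho_mu_linear(1-5)[symmetric] del: rho_mu_linear)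

lemma rho_mu_zero [simp]:
  "\<rho> 0 v = 0" "\<rho> a 0 = 0" "\<mu> 0 b v = 0" "\<mu> a 0 v = 0" "\<mu> a b 0 = 0"
  using rho_mu_diff(1)[of 0 0] rho_mu_diff(2)[of _ 0 0] rho_mu_diff(3)[of 0 0]
    rho_mu_diff(4)[of _ 0 0] rho_mu_diff(5)[of _ _ 0 0] by simp_all

lemma D_additivity [simp]:
  "D (a + a') b v = D a b v + D a' b v" "D a (b + b') v = D a b v + D a b' v"
  "D a b (v + v') = D a b v + D a b v'"
  "D (a - a') b v = D a b v - D a' b v" "D a (b - b') v = D a b v - D a b' v"
  "D a b (v - v') = D a b v - D a b v'"
  "D (sg k a) b v = sv k (D a b v)" "D a (sg k b) v = sv k (D a b v)"
  "D a b (sv k v) = sv k (D a b v)"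
  "D a a v = 0" "D 0 b v = 0" "D a 0 v = 0" "D a b 0 = 0"
  by (simp_all add: rep_D_def br_alt algebra_simps V.scale_right_diff_distrib V.scale_right_distrib)

lemma D_rho: "D x y (\<rho> z v) = \<rho> z (D x y v) + \<rho> (tr x y z) v"
  by (simp add: rep3)

lemma D_mu: "D x y (\<mu> z w v) = \<mu> z w (D x y v) + (\<mu> (tr x y z) w v + \<mu> z (tr x y w) v)"
  by (simp add: rep5)

text \<open>
  \<open>D z w\<close> is assembled from \<open>\<mu>\<close>, \<open>\<rho>\<close> and the bracket, and \<open>D x y\<close> acts as a derivation on each of
  them.
\<close>
lemma D_D: "D x y (D z w v) = D z w (D x y v) + (D (tr x y z) w v + D z (tr x y w) v)"
proof -
  note e = rep_D_def[of br \<rho> \<mu> z w] rep_D_def[of br \<rho> \<mu> "tr x y z" w] rep_D_def[of br \<rho> \<mu> z "tr x y w"]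
  show ?thesis
    unfolding e by (simp add: D_rho D_mu LY3 algebra_simps)
qed

text \<open>
  The coefficients $V\oplus\mathrm{Hom}(\mathfrak g,V)$. The two components of \<open>coeff_r x y (v, h)\<close> are
  $\delta_{\rm I}h(x,y)$ and $\delta_{\rm II}h(x,y,\cdot)$.
\<close>
definition coeff_scale :: "'k \<Rightarrow> 'v \<times> ('g \<Rightarrow> 'v) \<Rightarrow> 'v \<times> ('g \<Rightarrow> 'v)"
  where "coeff_scale k m = (sv k (fst m), \<lambda>z. sv k (snd m z))"

definition coeff_l :: "'g \<Rightarrow> 'g \<Rightarrow> 'v \<times> ('g \<Rightarrow> 'v) \<Rightarrow> 'v \<times> ('g \<Rightarrow> 'v)"
  where "coeff_l x y m = (D x y (fst m), \<lambda>z. D x y (snd m z) - snd m (tr x y z))"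

definition coeff_r :: "'g \<Rightarrow> 'g \<Rightarrow> 'v \<times> ('g \<Rightarrow> 'v) \<Rightarrow> 'v \<times> ('g \<Rightarrow> 'v)"
  where "coeff_r x y m =
    (\<rho> x (snd m y) - \<rho> y (snd m x) - snd m (br x y),
     \<lambda>z. D x y (snd m z) + \<mu> y z (snd m x) - \<mu> x z (snd m y) - snd m (tr x y z))"

definition coeffs :: "('v \<times> ('g \<Rightarrow> 'v)) set"
  where "coeffs = UNIV \<times> {h. Vector_Spaces.linear sg sv h}"


lemma coeffs_iff: "m \<in> coeffs \<longleftrightarrow> Vector_Spaces.linear sg sv (snd m)"
  by (cases m) (simp add: coeffs_def)

lemma linear_sg_sv_iff:
  "Vector_Spaces.linear sg sv h \<longleftrightarrow> (\<forall>x y. h (x + y) = h x + h y) \<and> (\<forall>c x. h (sg c x) = sv c (h x))"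
  by (simp add: Vector_Spaces.linear_iff vector_space_axioms V.vector_space_axioms)

lemma coeffs_apply:
  assumes "m \<in> coeffs"
  shows "snd m (x + y) = snd m x + snd m y" "snd m (x - y) = snd m x - snd m y"
    "snd m (sg c x) = sv c (snd m x)" "snd m 0 = 0"
proof -
  interpret Vector_Spaces.linear sg sv "snd m" using assms by (simp add: coeffs_iff)
  show "snd m (x + y) = snd m x + snd m y" "snd m (x - y) = snd m x - snd m y"
    "snd m (sg c x) = sv c (snd m x)" "snd m 0 = 0"
    by (simp_all add: add diff scale zero)
qed

lemma vector_space_coeff_scale: "vector_space coeff_scale"
  by unfold_locales
    (auto simp: coeff_scale_def prod_eq_iff V.scale_right_distrib V.scale_left_distrib)

text \<open>
  Both \<open>l_l\<close> and \<open>l_r\<close> express that \<open>D x y\<close> and \<open>tr x y\<close> act compatibly on all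
  structure maps. For \<open>r_l\<close> note that the second components of \<open>coeff_l x y m\<close> and \<open>coeff_r x y m\<close> differ by
  $z\mapsto\mu(x,z)h(y)-\mu(y,z)h(x)$. Maps of the form $z\mapsto\mu(x,z)v$ are killed by $\delta_{\rm I}$ and
  $\delta_{\rm II}$; this is the content of the second and of the fourth axiom of a representation.
\<close>
lemma leibniz_coefficients_coeff:
  "leibniz_coefficients sg coeff_scale tr coeff_l coeff_r coeffs"
proof -
  interpret C: vector_space coeff_scale by (rule vector_space_coeff_scale)
  interpret gC: vector_space_pair sg coeff_scale ..
  interpret CC: vector_space_pair coeff_scale coeff_scale ..
  note lin = gC.linear_def_iff CC.linear_def_iff
  note defs = coeff_l_def coeff_r_def coeff_scale_def prod_eq_iff fun_eq_iff
  show ?thesis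
  proof (rule leibniz_coefficients.intro[OF gC.vector_space_pair_axioms leibniz_coefficients_axioms.intro],
      goal_cases)
    case 1 show ?case by (rule tr_linear1)
  next
    case 2 show ?case by (rule tr_linear2)
  next
    case 3 show ?case by (rule tr_linear3)
  next
    case 4 show ?case by (rule tr_alt)
  next
    case 5 show ?case by (rule LY4)
  next
    case 6 show ?case
      by (auto simp: C.subspace_def coeffs_iff coeff_scale_def linear_sg_sv_iff
          V.scale_right_distrib V.scale_left_commute)
  next
    case (7 m x y) then show ?case
      by (simp add: coeffs_iff coeff_l_def linear_sg_sv_iff V.scale_right_distrib V.scale_right_diff_distrib)
  next
    case (8 m x y) then show ?case
      by (simp add: coeffs_iff coeff_r_def linear_sg_sv_iff V.scale_right_distrib V.scale_right_diff_distrib)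
  next
    case (9 m y) show ?case
      unfolding lin by (simp add: defs coeffs_apply[OF 9] V.scale_right_distrib V.scale_right_diff_distrib)
  next
    case (10 m x) show ?case
      unfolding lin by (simp add: defs coeffs_apply[OF 10] V.scale_right_distrib V.scale_right_diff_distrib)
  next
    case (11 x y) show ?case
      unfolding lin by (simp add: defs V.scale_right_distrib V.scale_right_diff_distrib)
  next
    case (12 m x) then show ?case
      by (simp add: defs coeffs_apply tr_alt)
  next
    case (13 m y) show ?case
      unfolding lin by (simp add: defs coeffs_apply[OF 13] V.scale_right_distrib V.scale_right_diff_distrib)
  next
    case (14 m x) show ?case
      unfolding lin by (simp add: defs coeffs_apply[OF 14] V.scale_right_distrib V.scale_right_diff_distrib)
  next
    case (15 x y) show ?case
      unfolding lin by (simp add: defs V.scale_right_distrib V.scale_right_diff_distrib)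
  next
    case (16 m x) then show ?case
      by (simp add: defs coeffs_apply tr_alt br_alt)
  next
    case (17 m x y z w)
    note h = coeffs_apply[OF 17]
    show ?case
      by (simp add: defs D_D[of x y z w] LY4[of x y z w] h algebra_simps)
  next
    case (18 m x y z w)
    note h = coeffs_apply[OF 18]
    show ?case
      by (simp add: defs D_D[of x y z w] LY4[of x y z w] LY3[of x y z w] D_rho[of x y] D_mu[of x y] h algebra_simps)
  next
    case (19 m z w x y)
    note h = coeffs_apply[OF 19]
    let ?h = "snd m"
    have e: "\<rho> b (\<mu> x a v) = \<rho> a (\<mu> x b v) - \<mu> x (br a b) v" for a b x v
      using rep2[of x a b v] by (simp add: algebra_simps)
    have e': "D a b (\<mu> x u v) = \<mu> x (tr a b u) v - \<mu> b u (\<mu> x a v) + \<mu> a u (\<mu> x b v)" for a b x u v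
      using rep4[of b u x a v] by (simp add: algebra_simps)
    let ?k = "\<lambda>u. \<mu> x u (?h y) - \<mu> y u (?h x)"
    have lr: "coeff_l x y m - coeff_r x y m = (D x y (fst m) - fst (coeff_r x y m), ?k)"
      by (simp add: coeff_l_def coeff_r_def fun_eq_iff)
    have "coeff_r z w (v, ?k) = 0" for v
      unfolding coeff_r_def
      by (simp add: prod_eq_iff fun_eq_iff e[of w _ z] e'[of z w] algebra_simps)
    moreover have "coeff_r z w (coeff_l x y m - coeff_r x y m) = coeff_r z w (coeff_l x y m) - coeff_r z w (coeff_r x y m)"
      by (simp add: defs algebra_simps)
    ultimately show ?case unfolding lr by simp
  qed
qed

end

sublocale ly_representation \<subseteq> L: leibniz_coefficients sg coeff_scale tr coeff_l coeff_r coeffs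
  by (rule leibniz_coefficients_coeff)

context ly_representation
begin

lemma wedge_hom_coeff_scale_iff:
  "wedge_hom sg coeff_scale n F \<longleftrightarrow>
     wedge_hom sg sv n (\<lambda>X. fst (F X)) \<and> (\<forall>z. wedge_hom sg sv n (\<lambda>X. snd (F X) z))"
proof -
  have *: "Vector_Spaces.linear sg coeff_scale G \<longleftrightarrow>
      Vector_Spaces.linear sg sv (\<lambda>x. fst (G x)) \<and> (\<forall>z. Vector_Spaces.linear sg sv (\<lambda>x. snd (G x) z))" for G
    unfolding L.linear_def_iff linear_sg_sv_iff by (auto simp: prod_eq_iff fun_eq_iff coeff_scale_def)
  show ?thesis
    unfolding wedge_hom_def * by (auto simp: prod_eq_iff fun_eq_iff)
qed

lemma cochain_iff:
  "L.cochain n F \<longleftrightarrow>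
     wedge_hom sg sv n (\<lambda>X. fst (F X)) \<and> (\<forall>z. wedge_hom sg sv n (\<lambda>X. snd (F X) z)) \<and>
     (\<forall>X. Vector_Spaces.linear sg sv (snd (F X)))"
  by (simp add: L.cochain_def wedge_hom_coeff_scale_iff image_subset_iff coeffs_iff)

lemma signed_components:
  "fst (signed k m) = signed k (fst m)" "snd (signed k m) z = signed k (snd m z)"
  by (simp_all add: signed_def)

lemma circ_eval_components:
  "fst (circ_eval t k j F X) = circ_eval t k j (\<lambda>Y. fst (F Y)) X"
  "snd (circ_eval t k j F X) z = circ_eval t k j (\<lambda>Y. snd (F Y) z) X"
  by (simp_all add: circ_eval_def split: prod.split)

lemma sum_apply: "(\<Sum>i\<in>I. f i) z = (\<Sum>i\<in>I. f i (z :: 'z) :: 'w::comm_monoid_add)"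
  by (induction I rule: infinite_finite_induct) auto

text \<open>
  In $\delta_{\rm II}$ the summand \<open>k = n + 1\<close> of the sums over \<open>D\<close> and \<open>tr\<close> joins the terms with
  \<open>\<mu>\<close> to form \<open>coeff_r\<close> at the last pair.
\<close>
lemma yam_delta_eq_coboundary:
  assumes F: "L.cochain n F"
  shows "yam_delta br tr \<rho> \<mu> n (\<lambda>X. fst (F X), \<lambda>X. snd (F X)) =
    (\<lambda>X. fst (L.coboundary F X), \<lambda>X. snd (L.coboundary F X))"
proof -
  have "yam_delta_I br tr \<rho> \<mu> n (\<lambda>X. fst (F X)) (\<lambda>X. snd (F X)) X = fst (L.coboundary F X)" for X
  proof (cases "length X = Suc n")
    case True
    show ?thesis
      using True unfolding L.coboundary_eq_sum[OF True] yam_delta_I_def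
      by (simp add: Let_def fst_sum signed_components circ_eval_components coeff_l_def coeff_r_def)
  next
    case False
    then show ?thesis by (simp add: yam_delta_I_def L.coboundary_off[OF F])
  qed
  moreover have "yam_delta_II br tr \<rho> \<mu> n (\<lambda>X. snd (F X)) X z = snd (L.coboundary F X) z" for X z
  proof (cases "length X = Suc n")
    case True
    have om: "omit (Suc n) X = take n X" using True by (simp add: omit_def)
    have s: "signed n (a - b) = signed n a - signed n b" for a b :: 'v and n by (simp add: signed_def)
    show ?thesis
      using True unfolding L.coboundary_eq_sum[OF True] yam_delta_II_def
      by (simp add: Let_def snd_sum sum_apply signed_components circ_eval_components coeff_l_def coeff_r_def
          om s signed_add sum_subtractf sum_negf)
  next
    case False
    then show ?thesis by (simp add: yam_delta_II_def L.coboundary_off[OF F])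
  qed
  ultimately show ?thesis by (simp add: yam_delta_def fun_eq_iff)
qed

text \<open>
  A linear map $h\in C^1$ is the degree-zero cochain \<open>(0, h)\<close>, and \<open>coeff_r\<close> was chosen to make its
  coboundary $\delta h$.
\<close>
lemma yam_delta1_eq_coboundary:
  assumes "Vector_Spaces.linear sg sv h"
  defines "F \<equiv> \<lambda>X. if X = [] then (0, h) else 0"
  shows "L.cochain 0 F"
    and "yam_delta1 br tr \<rho> \<mu> h = (\<lambda>X. fst (L.coboundary F X), \<lambda>X. snd (L.coboundary F X))"
proof -
  show F: "L.cochain 0 F"
    using assms(1) L.vs2.subspace_0[OF L.M_subspace]
    by (auto simp: L.cochain_def L.wedge_hom_0 F_def coeffs_iff)
  note d = L.coboundary_degree0[OF F]
  have "F [] = (0, h)" by (simp add: F_def)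
  then
  have "L.coboundary F X = (case X of [(x, y)] \<Rightarrow> coeff_r x y (0, h) | _ \<Rightarrow> 0)" for X
    by (cases "(F, X)" rule: L.coboundary.cases) (simp_all add: d split: list.split)
  then show "yam_delta1 br tr \<rho> \<mu> h = (\<lambda>X. fst (L.coboundary F X), \<lambda>X. snd (L.coboundary F X))"
    by (simp add: yam_delta1_def fun_eq_iff coeff_r_def split: list.split)
qed

end

section \<open>Adjoint representation and semidirect product\<close>

definition prod_scale :: "('k \<Rightarrow> 'g \<Rightarrow> 'g) \<Rightarrow> ('k \<Rightarrow> 'v \<Rightarrow> 'v) \<Rightarrow> 'k \<Rightarrow> 'g \<times> 'v \<Rightarrow> 'g \<times> 'v"
  where "prod_scale sg sv c p = (sg c (fst p), sv c (snd p))"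

lemma vector_space_prod_scale:
  assumes "vector_space sg" "vector_space sv"
  shows "vector_space (prod_scale sg sv)"
  using assms by (auto simp: vector_space_def prod_scale_def prod_eq_iff)

context lie_yamaguti_algebra
begin

lemma br_tr_neg [simp]:
  "br (- a) b = - br a b" "br a (- b) = - br a b"
  "tr (- a) b c = - tr a b c" "tr a (- b) c = - tr a b c" "tr a b (- c) = - tr a b c"
  using br_tr_diff(1)[of 0 a b] br_tr_diff(2)[of a 0 b] br_tr_diff(3)[of 0 a b c]
    br_tr_diff(4)[of a 0 b c] br_tr_diff(5)[of a b 0 c] by simp_all

text \<open>A rearrangement of the generalized Jacobi identity \<open>LY1\<close>.\<close>
lemma rep_D_adjoint: "rep_D br br (adj_mu tr) x y z = tr x y z"
proof -
  have e: "br (br y z) x = - br x (br y z)" "br (br z x) y = br y (br x z)" "tr y z x = - tr z y x"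
    using br_skew[of x "br y z"] br_skew[of "br z x" y] br_skew[of z x] tr_skew[of z y x] by simp_all
  have "rep_D br br (adj_mu tr) x y z - tr x y z =
      - (br (br x y) z + br (br y z) x + br (br z x) y + tr x y z + tr y z x + tr z x y)"
    unfolding e by (simp add: rep_D_def adj_mu_def algebra_simps)
  then show ?thesis by (simp add: LY1)
qed

lemma adjoint_representation: "ly_representation sg br tr sg br (adj_mu tr)"
proof (rule ly_representation.intro[OF lie_yamaguti_algebra_axioms vector_space_axioms
      ly_representation_axioms.intro], goal_cases)
  case 1 show ?case by (rule br_linear1)
next
  case 2 show ?case by (rule br_linear2)
next
  case (3 y v) show ?case unfolding adj_mu_def by (rule tr_linear2)
next
  case (4 x v) show ?case unfolding adj_mu_def by (rule tr_linear3)
next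
  case (5 x y) show ?case unfolding adj_mu_def by (rule tr_linear1)
next
  case (6 x y z v)
  show ?case
    using LY2[of x y v z] by (simp add: adj_mu_def tr_skew[of "br x y" v] br_skew[of v x] algebra_simps)
next
  case (7 x y z v)
  show ?case
    by (simp add: adj_mu_def LY3 br_skew[of "tr v x y" z])
next
  case (8 x y z v)
  show ?case by (simp add: rep_D_adjoint LY3)
next
  case (9 z w x y v)
  show ?case
    by (simp add: rep_D_adjoint adj_mu_def LY4[of v x y z w] tr_skew[of "tr v x z" y] algebra_simps)
next
  case (10 x y z w v)
  show ?case
    by (simp add: rep_D_adjoint adj_mu_def LY4[of x y v z w] algebra_simps)
qed

end

context ly_representation
begin

lemma mu_br_left: "\<mu> (br x y) z v = \<mu> x z (\<rho> y v) - \<mu> y z (\<rho> x v)"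
  using rep1[of x y z v] by (simp add: algebra_simps)

lemma mu_br_right: "\<mu> x (br y z) v = \<rho> y (\<mu> x z v) - \<rho> z (\<mu> x y v)"
  using rep2[of x y z v] by (simp add: algebra_simps)

lemma mu_tr_right: "\<mu> x (tr y z w) v = \<mu> z w (\<mu> x y v) - \<mu> y w (\<mu> x z v) + D y z (\<mu> x w v)"
  using rep4[of z w x y v] by (simp add: algebra_simps)

text \<open>
  The first two axioms of a representation turn the contributions of \<open>\<mu>\<close> into commutators of \<open>\<rho>\<close> with
  \<open>D\<close>, hence into values of \<open>\<rho>\<close> at ternary products. Together with the contributions of
  double brackets these are \<open>\<rho>\<close> applied to the generalized Jacobi identity.
\<close>
lemma D_cyclic: "D (br x y) z v + D (br y z) x v + D (br z x) y v = 0"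
proof -
  have "\<rho> (br (br x y) z) v + \<rho> (br (br y z) x) v + \<rho> (br (br z x) y) v
      + \<rho> (tr x y z) v + \<rho> (tr y z x) v + \<rho> (tr z x y) v = 0"
    unfolding rho_mu_linear(1)[symmetric] LY1 by simp
  then have "\<rho> (br (br x y) z) v + \<rho> (br (br y z) x) v + \<rho> (br (br z x) y) v =
     - (D x y (\<rho> z v) - \<rho> z (D x y v)) - (D y z (\<rho> x v) - \<rho> x (D y z v)) - (D z x (\<rho> y v) - \<rho> y (D z x v))"
    by (simp add: rep3 algebra_simps eq_neg_iff_add_eq_0)
  then have J: "\<rho> (br (br x y) z) v = - \<rho> (br (br y z) x) v - \<rho> (br (br z x) y) v
     - (D x y (\<rho> z v) - \<rho> z (D x y v)) - (D y z (\<rho> x v) - \<rho> x (D y z v)) - (D z x (\<rho> y v) - \<rho> y (D z x v))"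
    by (simp add: algebra_simps)
  show ?thesis
    by (simp add: rep_D_def mu_br_left mu_br_right J algebra_simps)
qed

text \<open>
  In each axiom the component in \<open>V\<close> is linear in the components in \<open>V\<close> of the arguments, and
  comparing coefficients gives back one of the identities for \<open>D\<close>, \<open>\<rho>\<close> and \<open>\<mu>\<close>.
\<close>
lemma semidirect_product:
  "lie_yamaguti_algebra (prod_scale sg sv) (semi_br br \<rho>) (semi_tr br tr \<rho> \<mu>)"
proof -
  interpret S: vector_space "prod_scale sg sv" by (rule vector_space_prod_scale) unfold_locales
  interpret SS: vector_space_pair "prod_scale sg sv" "prod_scale sg sv" ..
  have B: "semi_br br \<rho> p q = (br (fst p) (fst q), \<rho> (fst p) (snd q) - \<rho> (fst q) (snd p))" for p q
    by (simp add: semi_br_def split: prod.split)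
  have T: "semi_tr br tr \<rho> \<mu> p q e = (tr (fst p) (fst q) (fst e),
      D (fst p) (fst q) (snd e) + \<mu> (fst q) (fst e) (snd p) - \<mu> (fst p) (fst e) (snd q))" for p q e
    by (simp add: semi_tr_def split: prod.split)
  note BT = B T prod_eq_iff
  note sc = prod_scale_def scale_right_distrib scale_right_diff_distrib V.scale_right_distrib V.scale_right_diff_distrib
  show ?thesis
  proof (rule lie_yamaguti_algebra.intro[OF S.vector_space_axioms lie_yamaguti_algebra_axioms.intro],
      goal_cases)
    case (1 y) show ?case unfolding SS.linear_def_iff by (simp add: BT sc)
  next
    case (2 y) show ?case unfolding SS.linear_def_iff by (simp add: BT sc)
  next
    case (3 y) show ?case by (simp add: BT br_alt)
  next
    case (4 y z) show ?case unfolding SS.linear_def_iff by (simp add: BT sc)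
  next
    case (5 y z) show ?case unfolding SS.linear_def_iff by (simp add: BT sc)
  next
    case (6 y z) show ?case unfolding SS.linear_def_iff by (simp add: BT sc)
  next
    case (7 y) show ?case by (simp add: BT tr_alt)
  next
    case (8 x y z) show ?case
      using LY1[of "fst x" "fst y" "fst z"] by (simp add: BT) (simp add: rep_D_def algebra_simps)
  next
    case (9 x y z w) show ?case
      using LY2[of "fst x" "fst y" "fst z" "fst w"] D_cyclic[of "fst x" "fst y" "fst z" "snd w"]
      by (simp add: BT) (simp add: mu_br_left algebra_simps)
  next
    case (10 x y z w) show ?case
      by (simp add: BT LY3 D_rho mu_br_right algebra_simps)
  next
    case (11 x y z w e) show ?case
      by (simp add: BT LY4[of "fst x" "fst y" "fst z" "fst w" "fst e"] D_D[of "fst x" "fst y" "fst z" "fst w"]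
          D_mu[of "fst x" "fst y"] mu_tr_right[of "fst x" "fst z" "fst w"] mu_tr_right[of "fst y" "fst z" "fst w"]
          algebra_simps)
  qed
qed

end

section \<open>Cochains of a direct sum that commute with doubling a summand\<close>

text \<open>
  Lists in which every entry lies in one of the two summands, with the number of entries from \<open>V\<close>. The
  number is not determined by the list, since zero lies in both.
\<close>
inductive pure_list :: "nat \<Rightarrow> (('g::zero \<times> 'v::zero) \<times> ('g \<times> 'v)) list \<Rightarrow> bool"
  where
    "pure_list 0 []"
  | "pure_list k Z \<Longrightarrow> pure_list k (((x, 0), (y, 0)) # Z)"
  | "pure_list k Z \<Longrightarrow> pure_list (Suc k) (((x, 0), (0, v)) # Z)"
  | "pure_list k Z \<Longrightarrow> pure_list (Suc k) (((0, u), (y, 0)) # Z)"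
  | "pure_list k Z \<Longrightarrow> pure_list (Suc (Suc k)) (((0, u), (0, v)) # Z)"

lemma pure_list_0: "pure_list k Z \<Longrightarrow> k = 0 \<Longrightarrow> \<exists>X. Z = map in_pair X"
proof (induction rule: pure_list.induct)
  case (2 k Z x y)
  then obtain X where "Z = map in_pair X" by auto
  then show ?case by (intro exI[of _ "(x, y) # X"]) (simp add: in_pair_def)
qed simp_all

lemma pure_list_1:
  "pure_list k Z \<Longrightarrow> k = Suc 0 \<Longrightarrow> \<exists>X x v Y. Z = map in_pair X @ ((x, 0), (0, v)) # map in_pair Y \<or>
     Z = map in_pair X @ ((0, v), (x, 0)) # map in_pair Y"
proof (induction rule: pure_list.induct)
  case (2 k Z x y)
  then obtain X x' v Y where "Z = map in_pair X @ ((x', 0), (0, v)) # map in_pair Y \<or>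
     Z = map in_pair X @ ((0, v), (x', 0)) # map in_pair Y" by auto
  then show ?case
    by (intro exI[of _ "(x, y) # X"] exI[of _ x'] exI[of _ v] exI[of _ Y]) (simp add: in_pair_def)
next
  case (3 k Z x v)
  then obtain Y where "Z = map in_pair Y" using pure_list_0 by blast
  then show ?case by (intro exI[of _ "[]"] exI[of _ x] exI[of _ v] exI[of _ Y]) simp
next
  case (4 k Z v x)
  then obtain Y where "Z = map in_pair Y" using pure_list_0 by blast
  then show ?case by (intro exI[of _ "[]"] exI[of _ x] exI[of _ v] exI[of _ Y]) simp
qed simp_all

locale direct_sum = vector_space_pair sg sv
  for sg :: "'k::field_char_0 \<Rightarrow> 'g::ab_group_add \<Rightarrow> 'g" and sv :: "'k \<Rightarrow> 'v::ab_group_add \<Rightarrow> 'v"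
begin

abbreviation "sgv \<equiv> prod_scale sg sv"

lemma vector_spaces [simp]: "vector_space sg" "vector_space sv" "vector_space sgv"
  by (rule vs1.vector_space_axioms vs2.vector_space_axioms
      vector_space_prod_scale[OF vs1.vector_space_axioms vs2.vector_space_axioms])+

lemma sgv_simp [simp]: "sgv c (x, v) = (sg c x, sv c v)" "fst (sgv c p) = sg c (fst p)" "snd (sgv c p) = sv c (snd p)"
  by (simp_all add: prod_scale_def)

text \<open>The operator $\sigma$ that detects the number of entries in \<open>V\<close>.\<close>
definition double_V :: "'g \<times> 'v \<Rightarrow> 'g \<times> 'v"
  where "double_V p = (fst p, sv 2 (snd p))"

abbreviation "double_Vs \<equiv> map (map_prod double_V double_V)"

lemma linear_maps [simp]:
  "Vector_Spaces.linear sgv sg fst" "Vector_Spaces.linear sgv sv snd"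
  "Vector_Spaces.linear sg sgv (\<lambda>x. (x, 0))" "Vector_Spaces.linear sv sgv (Pair 0)"
  "Vector_Spaces.linear sgv sgv double_V"
  by (simp_all add: Vector_Spaces.linear_iff double_V_def vs2.scale_right_distrib vs2.scale_left_commute)

lemma wedge_hom_pairs:
  "wedge_hom s sgv n F \<longleftrightarrow> wedge_hom s sg n (\<lambda>X. fst (F X)) \<and> wedge_hom s sv n (\<lambda>X. snd (F X))"
  by (auto simp: wedge_hom_def Vector_Spaces.linear_iff prod_eq_iff)

lemma g_pair_eq: "g_pair = map_prod fst fst"
  by (auto simp: g_pair_def)

lemma in_pair_eq: "in_pair = map_prod (\<lambda>x. (x, 0)) (\<lambda>x. (x, 0))"
  by (auto simp: in_pair_def)

text \<open>Every pair is a sum of four pure ones.\<close>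
lemma vanish_from_pure:
  assumes r: "vector_space r"
  shows "wedge_hom sgv r n h \<Longrightarrow> (\<And>k Z. pure_list k Z \<Longrightarrow> h Z = 0) \<Longrightarrow> h Z = 0"
proof (induction n arbitrary: h Z)
  case 0
  interpret P: vector_space_pair sgv r using r by (simp add: vector_space_pair_def)
  show ?case
  proof (cases "Z = []")
    case True
    then show ?thesis using 0(2)[of 0 Z] by (simp add: pure_list.intros(1))
  next
    case False
    then show ?thesis using 0(1) by (simp add: P.wedge_hom_0)
  qed
next
  case (Suc n)
  interpret P: vector_space_pair sgv r using r by (simp add: vector_space_pair_def)
  note h = Suc.prems(1)
  show ?case
  proof (cases Z)
    case Nil
    then show ?thesis by (simp add: P.wedge_hom_head(6)[OF h])
  next
    case (Cons e Z')
    obtain x u y v where e: "e = ((x, u), (y, v))" by (metis surj_pair)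
    have zero: "h (p # Z') = 0" if "\<And>k Z. pure_list k Z \<Longrightarrow> \<exists>k'. pure_list k' (p # Z)" for p
      by (rule Suc.IH[OF P.wedge_hom_Cons[OF h]]) (use that Suc.prems(2) in blast)
    have zeros: "h (((x, 0), (y, 0)) # Z') = 0" "h (((x, 0), (0, v)) # Z') = 0"
      "h (((0, u), (y, 0)) # Z') = 0" "h (((0, u), (0, v)) # Z') = 0"
      by (rule zero; blast intro: pure_list.intros)+
    have "h Z = h (((x, 0) + (0, u), (y, 0) + (0, v)) # Z')"
      by (simp add: Cons e)
    also have "\<dots> = 0"
      unfolding P.wedge_hom_head(1,2)[OF h] by (simp add: zeros)
    finally show ?thesis .
  qed
qed

lemma pure_list_homogeneous:
  assumes r: "vector_space r"
  shows "pure_list k Z \<Longrightarrow> wedge_hom sgv r n h \<Longrightarrow> h (double_Vs Z) = r (2 ^ k) (h Z)"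
proof (induction arbitrary: n h rule: pure_list.induct)
  interpret P: vector_space_pair sgv r using r by (simp add: vector_space_pair_def)
  {
    case 1 show ?case by simp
  next
    fix k Z n h and p q :: "'g \<times> 'v" and a b :: nat
    assume h: "wedge_hom sgv r n h"
      and IH: "\<forall>n h. wedge_hom sgv r n h \<longrightarrow> h (double_Vs Z) = r (2 ^ k) (h Z)"
      and p: "double_V p = sgv (2 ^ a) p" and q: "double_V q = sgv (2 ^ b) q"
    have "h (double_Vs ((p, q) # Z)) = r (2 ^ (a + b + k)) (h ((p, q) # Z))"
    proof (cases n)
      case 0
      then show ?thesis using h by (simp add: P.wedge_hom_0)
    next
      case (Suc m)
      note h = h[unfolded Suc]
      show ?thesis
        using IH[rule_format, OF P.wedge_hom_Cons[OF h, of "(p, q)"]]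
        by (simp add: p q P.wedge_hom_head(3,4)[OF h] power_add mult.commute mult.left_commute)
    qed
  }
  note step = this
  have d: "double_V (x, 0) = sgv (2 ^ 0) (x, 0)" "double_V (0, v) = sgv (2 ^ 1) (0, v)" for x v
    by (simp_all add: double_V_def)
  {
    case (2 k Z x y) then show ?case using step[OF 2(3) _ d(1) d(1), of Z k] 2(2) by simp
  next
    case (3 k Z x v) then show ?case using step[OF 3(3) _ d(1) d(2), of Z k] 3(2) by simp
  next
    case (4 k Z u y) then show ?case using step[OF 4(3) _ d(2) d(1), of Z k] 4(2) by simp
  next
    case (5 k Z u v) then show ?case using step[OF 5(3) _ d(2) d(2), of Z k] 5(2) by simp
  }
qed

text \<open>
  On a pure list with \<open>k\<close> entries in \<open>V\<close> the substitution multiplies the value by $2^k$ and, by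
  assumption, by \<open>c\<close>. So only the lists with $2^k=c$ can have a nonzero value.
\<close>
lemma vanish_from_weight:
  assumes r: "vector_space r" and h: "wedge_hom sgv r n h"
    and w: "\<And>Z. h (double_Vs Z) = r c (h Z)"
    and z: "\<And>k Z. pure_list k Z \<Longrightarrow> 2 ^ k = c \<Longrightarrow> h Z = 0"
  shows "h Z = 0"
proof (rule vanish_from_pure[OF r h])
  interpret R: vector_space r by fact
  fix k Z assume p: "pure_list k (Z :: (('g \<times> 'v) \<times> ('g \<times> 'v)) list)"
  have "r (2 ^ k) (h Z) = r c (h Z)"
    by (rule trans[OF sym[OF pure_list_homogeneous[OF r p h]] w])
  then have "2 ^ k = c \<or> h Z = 0" by auto
  then show "h Z = 0" using z[OF p] by blast
qed

lemma power_two_eq [simp]: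
  "(2::'k) ^ k = 1 \<longleftrightarrow> k = 0" "(2::'k) ^ k = 2 \<longleftrightarrow> k = 1" "(2::'k) ^ k * 2 \<noteq> 1"
proof -
  have *: "(2::'k) ^ a = 2 ^ b \<longleftrightarrow> a = b" for a b
  proof -
    have "(2::'k) ^ a = of_nat (2 ^ a)" "(2::'k) ^ b = of_nat (2 ^ b)" by simp_all
    then show ?thesis by (simp only: of_nat_eq_iff) simp
  qed
  show "(2::'k) ^ k = 1 \<longleftrightarrow> k = 0" "(2::'k) ^ k = 2 \<longleftrightarrow> k = 1"
    using *[of k 0] *[of k 1] by simp_all
  show "(2::'k) ^ k * 2 \<noteq> 1"
    using *[of "Suc k" 0] by (simp add: mult.commute)
qed

text \<open>
  The cochains $(f,g)$ of $\mathfrak g\oplus V$ with values in itself that commute with $\sigma$. These are the ones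
  of total weight zero, that is, the lifts.
\<close>
definition equivariant where
  "equivariant n F \<longleftrightarrow>
    wedge_hom sgv sgv n (fst F) \<and> (\<forall>z. wedge_hom sgv sgv n (\<lambda>X. snd F X z)) \<and>
    (\<forall>X. Vector_Spaces.linear sgv sgv (snd F X)) \<and>
    (\<forall>X. fst F (double_Vs X) = double_V (fst F X)) \<and>
    (\<forall>X z. snd F (double_Vs X) (double_V z) = double_V (snd F X z))"

lemma equivariant_diff: "equivariant n F \<Longrightarrow> equivariant n G \<Longrightarrow> equivariant n (F - G)"
proof -
  interpret P: vector_space_pair sgv sgv by (simp add: vector_space_pair_def)
  have d: "double_V (p - q) = double_V p - double_V q" for p q by (simp add: double_V_def vs2.scale_right_diff_distrib)
  show "equivariant n F \<Longrightarrow> equivariant n G \<Longrightarrow> equivariant n (F - G)"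
    unfolding equivariant_def by (simp add: P.wedge_hom_diff P.linear_compose_sub d fun_diff_def)
qed

lemma restr_diff: "restr n (F - G) = restr n F - restr n G"
proof -
  have "restr n ((f, g) - (f', g')) = restr n (f, g) - restr n (f', g')" for f g f' g'
    by (auto simp: restr_def fun_eq_iff)
  then show ?thesis by (cases F; cases G) blast
qed

text \<open>
  Each of the two components of \<open>f\<close>, and of \<open>g\<close> with its last argument in one of the summands, is
  multiplied by a fixed scalar under $\sigma$: this is $1$, $2$ or $1/2$, depending on the target and on the last
  argument. Hence it is determined by its values on pure lists with no entry, one entry or no list at
  all, and \<open>restr\<close> records these values.
\<close>
lemma restr_zero_imp_zero:
  assumes F: "equivariant n F" and z: "restr n F = 0"
  shows "F = 0"
proof -
  obtain f g where Ffg: "F = (f, g)" by fastforce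
  have f: "wedge_hom sgv sgv n f" and g: "\<And>z. wedge_hom sgv sgv n (\<lambda>X. g X z)"
    and gl: "\<And>X. Vector_Spaces.linear sgv sgv (g X)"
    and fd: "\<And>X. f (double_Vs X) = double_V (f X)" and gd: "\<And>X z. g (double_Vs X) (double_V z) = double_V (g X z)"
    using F by (auto simp: equivariant_def Ffg)
  have r: "fst (f (map in_pair X)) = 0" "fst (g (map in_pair X) (x, 0)) = 0"
    "snd (f (map in_pair X @ [((x, 0), (0, v))])) = 0" "snd (g (map in_pair X) (0, v)) = 0" for X x v
    using z by (simp_all add: restr_def Ffg prod_eq_iff fun_eq_iff)
  have rest:
    "\<forall>i X x v Y. (if i \<in> {1..n - 1} \<and> length X = i - 1 \<and> length Y = n - i
       then snd (f (map in_pair X @ [((x, 0), (0, v))] @ map in_pair Y)) else 0) = 0"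
    "\<forall>j X x v Y z. (if j \<in> {1..n} \<and> length X = j - 1 \<and> length Y = n - j
       then snd (g (map in_pair X @ [((x, 0), (0, v))] @ map in_pair Y) (z, 0)) else 0) = 0"
    using z by (simp_all add: restr_def Ffg prod_eq_iff fun_eq_iff)
  have rf: "snd (f (map in_pair X @ ((x, 0), (0, v)) # map in_pair Y)) = 0" for X x v Y
  proof (cases "length X + Suc (length Y) = n")
    case True
    then show ?thesis
      using rest(1)[rule_format, of "Suc (length X)" X Y x v] r(3)[of X x v]
      by (cases Y) (simp_all add: True[symmetric])
  next
    case False
    then show ?thesis using f by (simp add: wedge_hom_def)
  qed
  have rg: "snd (g (map in_pair X @ ((x, 0), (0, v)) # map in_pair Y) (z, 0)) = 0" for X x v Y z
  proof (cases "length X + Suc (length Y) = n")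
    case True
    then show ?thesis
      using rest(2)[rule_format, of "Suc (length X)" X Y x v z] by (simp add: True[symmetric])
  next
    case False
    then show ?thesis using g[of "(z, 0)"] by (simp add: wedge_hom_def)
  qed
  note comp = wedge_hom_compose[where t = sgv]
  have zero1: "h Z = 0" if h: "wedge_hom sgv r n h" and r: "vector_space r"
      and w: "\<And>Z. h (double_Vs Z) = h Z" and z: "\<And>X. h (map in_pair X) = 0"
    for h and r :: "'k \<Rightarrow> 'w::ab_group_add \<Rightarrow> 'w" and Z
  proof (rule vanish_from_weight[OF r h, of 1])
    interpret R: vector_space r by fact
    show "h (double_Vs Z) = r 1 (h Z)" for Z by (simp add: w)
    show "h Z = 0" if "pure_list k Z" "2 ^ k = (1::'k)" for k Z
      using pure_list_0[OF that(1)] that(2) z by auto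
  qed
  have zero2: "h Z = 0" if h: "wedge_hom sgv sv n h"
      and w: "\<And>Z. h (double_Vs Z) = sv 2 (h Z)"
      and z: "\<And>X x v Y. h (map in_pair X @ ((x, 0), (0, v)) # map in_pair Y) = 0"
    for h Z
  proof (rule vanish_from_weight[OF _ h, of 2])
    interpret P: vector_space_pair sgv sv by (simp add: vector_space_pair_def)
    show "h (double_Vs Z) = sv 2 (h Z)" for Z by (simp add: w)
    have "h (map in_pair X @ ((0, v), (x, 0)) # map in_pair Y) = 0" for X x v Y
      using P.wedge_hom_slot(3)[OF h, of "map in_pair X" "(x, 0)" "(0, v)" "map in_pair Y"] z by simp
    then show "h Z = 0" if "pure_list k Z" "2 ^ k = (2::'k)" for k Z
      using pure_list_1[OF that(1)] that(2) z by auto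
  qed simp
  have f1: "fst (f Z) = 0" for Z
    by (rule zero1[OF comp[OF f linear_maps(1)]]) (simp_all add: fd r double_V_def)
  have f2: "snd (f Z) = 0" for Z
    by (rule zero2[OF comp[OF f linear_maps(2)]]) (simp_all add: fd rf double_V_def)
  have gz: "g (double_Vs Z) (x, 0) = double_V (g Z (x, 0))" for Z x
    using gd[of Z "(x, 0)"] by (simp add: double_V_def)
  have gw: "fst (g (double_Vs Z) (0, v)) = sg (1 / 2) (fst (g Z (0, v)))"
    "snd (g (double_Vs Z) (0, v)) = snd (g Z (0, v))" for Z v
  proof -
    interpret gl: Vector_Spaces.linear sgv sgv "g (double_Vs Z)" by (rule gl)
    have e: "sgv 2 (g (double_Vs Z) (0, v)) = double_V (g Z (0, v))"
      using gd[of Z "(0, v)"] gl.scale[of 2 "(0, v)"] by (simp add: double_V_def)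
    have "sg (1 / 2) (sg 2 (fst (g (double_Vs Z) (0, v)))) = sg (1 / 2) (fst (g Z (0, v)))"
      "sv (1 / 2) (sv 2 (snd (g (double_Vs Z) (0, v)))) = sv (1 / 2) (sv 2 (snd (g Z (0, v))))"
      using arg_cong[OF e, of fst] arg_cong[OF e, of snd] by (simp_all only: sgv_simp double_V_def fst_conv snd_conv)
    then show "fst (g (double_Vs Z) (0, v)) = sg (1 / 2) (fst (g Z (0, v)))"
      "snd (g (double_Vs Z) (0, v)) = snd (g Z (0, v))" by simp_all
  qed
  have g1: "fst (g Z (x, 0)) = 0" for Z x
    by (rule zero1[OF comp[OF g linear_maps(1)]]) (simp_all add: gz r double_V_def)
  have g2: "snd (g Z (x, 0)) = 0" for Z x
    by (rule zero2[OF comp[OF g linear_maps(2)]]) (simp_all add: gz rg double_V_def)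
  \<comment> \<open>The argument in \<open>V\<close> already has weight one while the target has weight zero, and $1/2$ is not of the
    form $2^k$.\<close>
  have g3: "fst (g Z (0, v)) = 0" for Z v
    by (rule vanish_from_weight[OF _ comp[OF g linear_maps(1)], where c = "1 / 2"]) (simp_all add: gw)
  have g4: "snd (g Z (0, v)) = 0" for Z v
    by (rule zero1[OF comp[OF g linear_maps(2)]]) (simp_all add: gw r)
  have "g Z (x, v) = 0" for Z x v
  proof -
    interpret gl: Vector_Spaces.linear sgv sgv "g Z" by (rule gl)
    have "g Z ((x, 0) + (0, v)) = 0"
      unfolding gl.add by (simp add: prod_eq_iff g1 g2 g3 g4)
    then show ?thesis by simp
  qed
  then show ?thesis
    by (simp add: Ffg prod_eq_iff fun_eq_iff f1 f2)
qed

section \<open>Lift and restriction are mutually inverse\<close>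

text \<open>
  The extension by zero of a map \<open>h\<close> on
  $(\wedge^2\mathfrak g)^{\otimes a}\otimes(\mathfrak g\wedge V)\otimes(\wedge^2\mathfrak g)^{\otimes(n-a-1)}$.
\<close>
definition mixed_at where
  "mixed_at n a h X = (if length X = n
     then mixed_ext (\<lambda>x v. h (map g_pair (take a X)) x v (map g_pair (drop (Suc a) X))) (X ! a) else 0)"

lemma mixed_ext_apply: "mixed_ext h e = h (fst (fst e)) (snd (snd e)) - h (fst (snd e)) (snd (fst e))"
  by (simp add: mixed_ext_def split: prod.split)

lemma wedge_hom_mixed_at:
  assumes h: "mixed_hom sg sv a b h" and n: "n = a + Suc b"
  shows "wedge_hom sgv sv n (mixed_at n a h)"
proof -
  interpret P: vector_space_pair sgv sv by (simp add: vector_space_pair_def)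
  have h1: "wedge_hom sg sv a (\<lambda>X. h X x v Y)" and h2: "Vector_Spaces.linear sg sv (\<lambda>x. h X x v Y)"
    and h3: "Vector_Spaces.linear sv sv (\<lambda>v. h X x v Y)" and h4: "wedge_hom sg sv b (h X x v)" for x v X Y
    using h by (auto simp: mixed_hom_def)
  show ?thesis
    unfolding mixed_at_def n
  proof (rule P.wedge_hom_glue[where H = "\<lambda>P e Q. mixed_ext (\<lambda>x v. h (map g_pair P) x v (map g_pair Q)) e"], goal_cases)
    case (1 e Q) then show ?case
      unfolding mixed_ext_apply g_pair_eq
      by (intro P.wedge_hom_diff wedge_hom_precompose[OF h1] linear_maps)
  next
    case (2 P e) then show ?case
      unfolding mixed_ext_apply g_pair_eq
      by (intro P.wedge_hom_diff wedge_hom_precompose[OF h4] linear_maps)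
  next
    case (3 P y Q) then show ?case
      using h2[of "map g_pair P" _ "map g_pair Q"] h3[of "map g_pair P" _ "map g_pair Q"]
      by (simp add: mixed_ext_apply Vector_Spaces.linear_iff vs2.scale_right_diff_distrib)
  next
    case (4 P y Q) then show ?case
      using h2[of "map g_pair P" _ "map g_pair Q"] h3[of "map g_pair P" _ "map g_pair Q"]
      by (simp add: mixed_ext_apply Vector_Spaces.linear_iff vs2.scale_right_diff_distrib)
  next
    case (5 P x Q) then show ?case by (simp add: mixed_ext_apply)
  qed
qed

lemma double_V_simps: "double_V (x, v) = (x, sv 2 v)" "fst (double_V p) = fst p" "snd (double_V p) = sv 2 (snd p)"
  by (simp_all add: double_V_def)

lemma g_pair_double_V [simp]: "g_pair \<circ> map_prod double_V double_V = g_pair"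
  by (auto simp: g_pair_eq double_V_def)

lemma mixed_at_double_Vs:
  assumes h: "mixed_hom sg sv a b h" and n: "n = a + Suc b"
  shows "mixed_at n a h (double_Vs X) = sv 2 (mixed_at n a h X)"
proof -
  have "h X x (sv c v) Y = sv c (h X x v Y)" for X x v Y c
    using h by (simp add: mixed_hom_def Vector_Spaces.linear_iff)
  then show ?thesis
    by (simp add: mixed_at_def n take_map drop_map mixed_ext_apply double_V_def vs2.scale_right_diff_distrib)
qed

lemma g_pair_in_pair [simp]: "g_pair \<circ> in_pair = id"
  by (auto simp: g_pair_def in_pair_def)

lemma mixed_at_in_pair:
  assumes h: "mixed_hom sg sv a b h" and n: "n = a + Suc b"
  shows "mixed_at n a h (map in_pair X) = 0"
    and "mixed_at n a h (map in_pair X @ ((x, 0), (0, v)) # map in_pair Y) =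
      (if length X = a \<and> length Y = b then h X x v Y else 0)"
proof -
  have h0: "h X x 0 Y = 0" for X x Y
  proof -
    interpret Vector_Spaces.linear sv sv "\<lambda>v. h X x v Y" using h by (simp add: mixed_hom_def)
    show ?thesis by (rule zero)
  qed
  have h0': "h X 0 v Y = 0" for X v Y
  proof -
    interpret Vector_Spaces.linear sg sv "\<lambda>x. h X x v Y" using h by (simp add: mixed_hom_def)
    show ?thesis by (rule zero)
  qed
  have i: "mixed_ext (\<lambda>x v. h P x v Q) (in_pair p) = 0" for P Q p
    by (cases p) (simp add: in_pair_def mixed_ext_def h0)
  show "mixed_at n a h (map in_pair X) = 0"
    by (simp add: mixed_at_def n i)
  show "mixed_at n a h (map in_pair X @ ((x, 0), (0, v)) # map in_pair Y) =
      (if length X = a \<and> length Y = b then h X x v Y else 0)"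
  proof (cases "length X + Suc (length Y) = n")
    case True
    consider "length X = a" | "a < length X" | "length X < a" by linarith
    then show ?thesis
    proof cases
      case 1
      then show ?thesis
        using True n by (simp add: mixed_at_def mixed_ext_def nth_append h0')
    next
      case 2
      then show ?thesis using True by (simp add: mixed_at_def nth_append i)
    next
      case 3
      then have "(map in_pair X @ ((x, 0), (0, v)) # map in_pair Y) ! a = in_pair (Y ! (a - Suc (length X)))"
        using True n by (simp add: nth_append nth_Cons')
      then show ?thesis using 3 by (simp add: mixed_at_def i)
    qed
  next
    case False
    then show ?thesis using n by (auto simp: mixed_at_def)
  qed
qed

text \<open>
  Views $f_2$, whose mixed slot is the last one, as a further member of the family $f_3$.
\<close>
abbreviation "last_slot f \<equiv> \<lambda>X x v Y. if Y = [] then f X x v else 0"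

lemma components_spaceD:
  assumes "(f1, g1, f2, g2, f3, g3) \<in> components_space sg sv n"
  shows "wedge_hom sg sg n f1" "\<And>z. wedge_hom sg sg n (\<lambda>X. g1 X z)" "\<And>X. Vector_Spaces.linear sg sg (g1 X)"
    "mixed_hom sg sv (n - 1) 0 (last_slot f2)"
    "\<And>v. wedge_hom sg sv n (\<lambda>X. g2 X v)" "\<And>X. Vector_Spaces.linear sv sv (g2 X)"
    "\<And>i. i \<in> {1..n - 1} \<Longrightarrow> mixed_hom sg sv (i - 1) (n - i) (f3 i)"
    "\<And>i. i \<notin> {1..n - 1} \<Longrightarrow> f3 i = 0"
    "\<And>j z. j \<in> {1..n} \<Longrightarrow> mixed_hom sg sv (j - 1) (n - j) (\<lambda>X x v Y. g3 j X x v Y z)"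
    "\<And>j X x v Y. j \<in> {1..n} \<Longrightarrow> Vector_Spaces.linear sg sv (g3 j X x v Y)"
    "\<And>j. j \<notin> {1..n} \<Longrightarrow> g3 j = 0"
proof -
  interpret P: vector_space_pair sv sv by (simp add: vector_space_pair_def)
  show "mixed_hom sg sv (n - 1) 0 (last_slot f2)"
    unfolding mixed_hom_def
  proof (intro conjI allI, goal_cases)
    case (1 x v Y)
    have "wedge_hom sg sv (n - 1) (\<lambda>X. f2 X x v)"
      using assms by (simp add: components_space_def)
    then show ?case by (cases "Y = []") (simp_all add: wedge_hom_zero)
  next
    case (2 X v Y)
    have "Vector_Spaces.linear sg sv (\<lambda>x. f2 X x v)"
      using assms by (simp add: components_space_def)
    then show ?case by (cases "Y = []") (simp_all add: linear_zero)
  next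
    case (3 X x Y)
    have "Vector_Spaces.linear sv sv (\<lambda>v. f2 X x v)"
      using assms by (simp add: components_space_def)
    then show ?case by (cases "Y = []") (simp_all add: P.linear_zero)
  next
    case (4 X x v)
    show ?case by (simp add: wedge_hom_0)
  qed
qed (use assms in \<open>simp_all add: components_space_def\<close>)

lemma lift_eq:
  assumes "c = (f1, g1, f2, g2, f3, g3)" "wedge_hom sg sg n f1" "\<And>z. wedge_hom sg sg n (\<lambda>X. g1 X z)"
    "\<And>v. wedge_hom sg sv n (\<lambda>X. g2 X v)" "n \<ge> 1"
  shows "fst (lift n c) X = (f1 (map g_pair X),
      mixed_at n (n - 1) (last_slot f2) X + (\<Sum>i = 1..n - 1. mixed_at n (i - 1) (f3 i) X))"
    and "snd (lift n c) X z = (g1 (map g_pair X) (fst z), g2 (map g_pair X) (snd z)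
      + (\<Sum>j = 1..n. mixed_at n (j - 1) (\<lambda>X x v Y. g3 j X x v Y (fst z)) X))"
proof -
  have off: "f1 (map g_pair X) = 0" "g1 (map g_pair X) x = 0" "g2 (map g_pair X) v = 0"
    if "length X \<noteq> n" for x v and X :: "(('g \<times> 'v) \<times> ('g \<times> 'v)) list"
    using that assms(2-4) by (simp_all add: wedge_hom_def)
  show "fst (lift n c) X = (f1 (map g_pair X),
      mixed_at n (n - 1) (last_slot f2) X + (\<Sum>i = 1..n - 1. mixed_at n (i - 1) (f3 i) X))"
    using assms(5) by (cases "length X = n") (auto simp: lift_def assms(1) mixed_at_def off zero_prod_def intro!: sum.cong)
  show "snd (lift n c) X z = (g1 (map g_pair X) (fst z), g2 (map g_pair X) (snd z)
      + (\<Sum>j = 1..n. mixed_at n (j - 1) (\<lambda>X x v Y. g3 j X x v Y (fst z)) X))"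
    using assms(5) by (cases z; cases "length X = n") (auto simp: lift_def assms(1) mixed_at_def off zero_prod_def intro!: sum.cong)
qed

text \<open>
  A map extended from inputs without entries in \<open>V\<close> depends on the components in $\mathfrak g$ only, which
  $\sigma$ fixes; one extended from inputs with one entry in \<open>V\<close> is linear in the single
  component in \<open>V\<close> that it sees.
\<close>
lemma equivariant_lift:
  assumes c: "c \<in> components_space sg sv n" and n: "n \<ge> 1"
  shows "equivariant n (lift n c)"
proof -
  interpret P: vector_space_pair sgv sv by (simp add: vector_space_pair_def)
  obtain f1 g1 f2 g2 f3 g3 where c_eq: "c = (f1, g1, f2, g2, f3, g3)" by (metis surj_pair)
  note d = components_spaceD[OF c[unfolded c_eq]]
  note w = d(1-7,9,10)
  note lift = lift_eq[OF c_eq w(1,2,5) n]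
  have slot: "n = i - 1 + Suc (n - i)" if "i \<in> {1..n}" for i using that n by auto
  have slot': "n = i - 1 + Suc (n - i)" if "i \<in> {1..n - 1}" for i using that n by auto
  have slotn: "n = n - 1 + Suc 0" using n by simp
  have pre: "wedge_hom sgv r n (\<lambda>X. h (map g_pair X))" if "wedge_hom sg r n h" for h and r :: "'k \<Rightarrow> 'w::ab_group_add \<Rightarrow> 'w"
    unfolding g_pair_eq by (rule wedge_hom_precompose[OF that linear_maps(1)])
  show ?thesis
    unfolding equivariant_def
  proof (intro conjI allI, goal_cases)
    case 1
    have "wedge_hom sgv sv n (\<lambda>X. \<Sum>i = 1..n - 1. mixed_at n (i - 1) (f3 i) X)"
      by (rule P.wedge_hom_sum) (simp_all only: finite_atLeastAtMost wedge_hom_mixed_at[OF w(7) slot'])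
    then show ?case
      unfolding wedge_hom_pairs lift fst_conv snd_conv
      by (intro conjI P.wedge_hom_add wedge_hom_mixed_at[OF w(4) slotn] pre w(1))
  next
    case (2 z)
    have "wedge_hom sgv sv n (\<lambda>X. \<Sum>j = 1..n. mixed_at n (j - 1) (\<lambda>X x v Y. g3 j X x v Y (fst z)) X)"
      by (rule P.wedge_hom_sum) (simp_all only: finite_atLeastAtMost wedge_hom_mixed_at[OF w(8) slot])
    then show ?case
      unfolding wedge_hom_pairs lift fst_conv snd_conv
      by (intro conjI P.wedge_hom_add pre w(2) w(5))
  next
    case (3 X)
    have m: "mixed_at n (j - 1) (\<lambda>X x v Y. g3 j X x v Y (z + z')) X =
        mixed_at n (j - 1) (\<lambda>X x v Y. g3 j X x v Y z) X + mixed_at n (j - 1) (\<lambda>X x v Y. g3 j X x v Y z') X"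
      "mixed_at n (j - 1) (\<lambda>X x v Y. g3 j X x v Y (sg k z)) X =
        sv k (mixed_at n (j - 1) (\<lambda>X x v Y. g3 j X x v Y z) X)" if "j \<in> {1..n}" for j z z' k
      using w(9)[OF that] by (simp_all add: Vector_Spaces.linear_iff mixed_at_def mixed_ext_apply vs2.scale_right_diff_distrib)
    let ?S = "\<lambda>z. \<Sum>j = 1..n. mixed_at n (j - 1) (\<lambda>X x v Y. g3 j X x v Y z) X"
    have "?S (z + z') = ?S z + ?S z'" for z z'
      unfolding sum.distrib[symmetric] by (rule sum.cong[OF refl m(1)])
    moreover have "?S (sg k z) = sv k (?S z)" for z k
      unfolding vs2.scale_sum_right by (rule sum.cong[OF refl m(2)])
    ultimately show ?case
      using w(3)[of "map g_pair X"] w(6)[of "map g_pair X"]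
      by (simp add: Vector_Spaces.linear_iff lift vs2.scale_right_distrib algebra_simps)
  next
    case (4 X)
    have "(\<Sum>i = 1..n - 1. mixed_at n (i - 1) (f3 i) (double_Vs X)) = sv 2 (\<Sum>i = 1..n - 1. mixed_at n (i - 1) (f3 i) X)"
      unfolding vs2.scale_sum_right by (rule sum.cong[OF refl mixed_at_double_Vs[OF w(7) slot']])
    then show ?case
      unfolding lift by (simp add: double_V_simps mixed_at_double_Vs[OF w(4) slotn] vs2.scale_right_distrib del: One_nat_def)
  next
    case (5 X z)
    have "(\<Sum>j = 1..n. mixed_at n (j - 1) (\<lambda>X x v Y. g3 j X x v Y (fst z)) (double_Vs X))
        = sv 2 (\<Sum>j = 1..n. mixed_at n (j - 1) (\<lambda>X x v Y. g3 j X x v Y (fst z)) X)"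
      unfolding vs2.scale_sum_right by (rule sum.cong[OF refl mixed_at_double_Vs[OF w(8) slot]])
    then show ?case
      using w(6)[of "map g_pair X"]
      unfolding lift by (simp add: double_V_simps vs2.scale_right_distrib Vector_Spaces.linear_iff del: One_nat_def)
  qed
qed

lemma restr_eq:
  "restr n F =
    (\<lambda>X. fst (fst F (map in_pair X)),
     \<lambda>X z. fst (snd F (map in_pair X) (z, 0)),
     \<lambda>X x v. snd (fst F (map in_pair X @ [((x, 0), (0, v))])),
     \<lambda>X v. snd (snd F (map in_pair X) (0, v)),
     \<lambda>i X x v Y. if i \<in> {1..n - 1} \<and> length X = i - 1 \<and> length Y = n - i
       then snd (fst F (map in_pair X @ ((x, 0), (0, v)) # map in_pair Y)) else 0,
     \<lambda>j X x v Y z. if j \<in> {1..n} \<and> length X = j - 1 \<and> length Y = n - j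
       then snd (snd F (map in_pair X @ ((x, 0), (0, v)) # map in_pair Y) (z, 0)) else 0)"
  by (simp only: restr_def split_def append_Cons append_Nil)

text \<open>
  On a list with exactly one mixed pair, of the form $x\wedge v$, all summands of the lift vanish except the
  one whose mixed slot is at that position.
\<close>
lemma restr_lift:
  assumes c: "c \<in> components_space sg sv n" and n: "n \<ge> 1"
  shows "restr n (lift n c) = c"
proof -
  obtain f1 g1 f2 g2 f3 g3 where c_eq: "c = (f1, g1, f2, g2, f3, g3)" by (metis surj_pair)
  note d = components_spaceD[OF c[unfolded c_eq]]
  note w = d(1-7,9,8,11,6)
  note lift = lift_eq[OF c_eq w(1,2,5) n]
  have slot: "n = i - 1 + Suc (n - i)" if "i \<in> {1..n}" for i using that n by auto
  have slot': "n = i - 1 + Suc (n - i)" if "i \<in> {1..n - 1}" for i using that n by auto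
  have slotn: "n = n - 1 + Suc 0" using n by simp
  have at3: "(\<Sum>i = 1..n - 1. mixed_at n (i - 1) (f3 i) (map in_pair X @ ((x, 0), (0, v)) # map in_pair Y))
      = (if Suc (length X) \<in> {1..n - 1} \<and> length Y = n - Suc (length X) then f3 (Suc (length X)) X x v Y else 0)" for X x v Y
  proof -
    let ?t = "\<lambda>i. mixed_at n (i - 1) (f3 i) (map in_pair X @ ((x, 0), (0, v)) # map in_pair Y)"
    let ?r = "\<lambda>i. f3 i X x v Y"
    have "(\<Sum>i = 1..n - 1. ?t i) = (\<Sum>i = 1..n - 1. if i = Suc (length X) then (if length Y = n - i then f3 i X x v Y else 0) else 0)"
    proof (rule sum.cong[OF refl])
      fix i assume i: "i \<in> {1..n - 1}"
      show "?t i = (if i = Suc (length X) then (if length Y = n - i then ?r i else 0) else 0)"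
        unfolding mixed_at_in_pair(2)[OF w(7)[OF i] slot'[OF i]] using i by auto
    qed
    then show ?thesis by (simp add: sum.delta del: One_nat_def)
  qed
  have at3': "(\<Sum>j = 1..n. mixed_at n (j - 1) (\<lambda>X x v Y. g3 j X x v Y z) (map in_pair X @ ((x, 0), (0, v)) # map in_pair Y))
      = (if Suc (length X) \<in> {1..n} \<and> length Y = n - Suc (length X) then g3 (Suc (length X)) X x v Y z else 0)" for X x v Y z
  proof -
    let ?t = "\<lambda>j. mixed_at n (j - 1) (\<lambda>X x v Y. g3 j X x v Y z) (map in_pair X @ ((x, 0), (0, v)) # map in_pair Y)"
    let ?r = "\<lambda>j. g3 j X x v Y z"
    have "(\<Sum>j = 1..n. ?t j) = (\<Sum>j = 1..n. if j = Suc (length X) then (if length Y = n - j then g3 j X x v Y z else 0) else 0)"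
    proof (rule sum.cong[OF refl])
      fix j assume j: "j \<in> {1..n}"
      show "?t j = (if j = Suc (length X) then (if length Y = n - j then ?r j else 0) else 0)"
        unfolding mixed_at_in_pair(2)[OF w(8)[OF j] slot[OF j]] using j by auto
    qed
    then show ?thesis by (simp add: sum.delta del: One_nat_def)
  qed
  have f2: "(if length X = n - 1 then f2 X x v else 0) = f2 X x v" for X x v
    using c by (auto simp: c_eq components_space_def wedge_hom_def)
  have f3: "f3 i X x v Y = 0" if "\<not> (i \<in> {1..n - 1} \<and> length X = i - 1 \<and> length Y = n - i)" for i X x v Y
  proof (cases "i \<in> {1..n - 1}")
    case True
    then have "wedge_hom sg sv (i - 1) (\<lambda>X. f3 i X x v Y)" "wedge_hom sg sv (n - i) (f3 i X x v)"
      using w(7) by (auto simp: mixed_hom_def)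
    then show ?thesis using that True by (auto simp: wedge_hom_def)
  qed (simp add: w(9))
  have g3: "g3 j X x v Y z = 0" if "\<not> (j \<in> {1..n} \<and> length X = j - 1 \<and> length Y = n - j)" for j X x v Y z
  proof (cases "j \<in> {1..n}")
    case True
    then have "wedge_hom sg sv (j - 1) (\<lambda>X. g3 j X x v Y z)" "wedge_hom sg sv (n - j) (\<lambda>Y. g3 j X x v Y z)"
      using w(8) by (auto simp: mixed_hom_def)
    then show ?thesis using that True by (auto simp: wedge_hom_def)
  qed (simp add: w(10))
  have F: "snd (fst (lift n c) (map in_pair X @ ((x, 0), (0, v)) # map in_pair Y)) =
      (if length X = n - 1 \<and> Y = [] then f2 X x v else 0) + (if Suc (length X) \<in> {1..n - 1} \<and> length Y = n - Suc (length X) then f3 (Suc (length X)) X x v Y else 0)"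
    for X x v Y
    by (simp only: lift snd_conv at3 mixed_at_in_pair(2)[OF w(4) slotn]) auto
  have G: "snd (snd (lift n c) (map in_pair X @ ((x, 0), (0, v)) # map in_pair Y) (z, 0)) =
      (if Suc (length X) \<in> {1..n} \<and> length Y = n - Suc (length X) then g3 (Suc (length X)) X x v Y z else 0)"
    for X x v Y z
  proof -
    have "g2 X' 0 = 0" for X'
    proof -
      interpret Vector_Spaces.linear sv sv "g2 X'" by (rule w(11))
      show ?thesis by (rule zero)
    qed
    then show ?thesis by (simp only: lift snd_conv fst_conv at3' add_0_left)
  qed
  show ?thesis
    unfolding restr_eq c_eq prod.inject
  proof (intro conjI ext, goal_cases)
    case (1 X)
    show ?case unfolding lift[unfolded c_eq] by simp
  next
    case (2 X z)
    show ?case unfolding lift[unfolded c_eq] by simp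
  next
    case (3 X x v)
    show ?case
      using F[of X x v "[]"] n f2[of X x v] by (auto simp: c_eq)
  next
    case (4 X v)
    have "(\<Sum>j = 1..n. mixed_at n (j - 1) (\<lambda>X x v Y. g3 j X x v Y 0) (map in_pair X)) = 0"
      by (rule sum.neutral, rule ballI) (rule mixed_at_in_pair(1)[OF w(8) slot]; assumption)
    then show ?case unfolding lift[unfolded c_eq] by simp
  next
    case (5 i X x v Y)
    show ?case
    proof (cases "i \<in> {1..n - 1} \<and> length X = i - 1 \<and> length Y = n - i")
      case True
      then have "Y \<noteq> []" "Suc (length X) = i" by auto
      then show ?thesis using True F[of X x v Y] by (simp add: c_eq)
    next
      case False
      show ?thesis by (subst if_not_P[OF False]) (simp only: f3[OF False])
    qed
  next
    case (6 j X x v Y z)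
    show ?case
    proof (cases "j \<in> {1..n} \<and> length X = j - 1 \<and> length Y = n - j")
      case True
      then have "Suc (length X) = j" by auto
      then show ?thesis using True G[of X x v Y z] by (simp add: c_eq)
    next
      case False
      show ?thesis by (subst if_not_P[OF False]) (simp only: g3[OF False])
    qed
  qed
qed

lemma mixed_hom_mixed_part:
  assumes k: "wedge_hom sgv sv n k" and n: "n = a + Suc b"
  shows "mixed_hom sg sv a b (\<lambda>X x v Y. if length X = a \<and> length Y = b
    then k (map in_pair X @ ((x, 0), (0, v)) # map in_pair Y) else 0)"
proof -
  interpret P: vector_space_pair sgv sv by (simp add: vector_space_pair_def)
  interpret VV: vector_space_pair sv sv by (simp add: vector_space_pair_def)
  have L: "wedge_hom sg sv a (\<lambda>X. k (map in_pair X @ e # map in_pair Y))" if "length Y = b" for e Y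
  proof -
    have "wedge_hom sgv sv a (\<lambda>X. k (X @ e # map in_pair Y))"
      by (rule P.wedge_hom_drop_suffix) (use k in \<open>simp add: that n\<close>)
    then show ?thesis unfolding in_pair_eq by (rule wedge_hom_precompose) simp
  qed
  have R: "wedge_hom sg sv b (\<lambda>Y. k (map in_pair X @ e # map in_pair Y))" if "length X = a" for e X
  proof -
    have "wedge_hom sgv sv (Suc b) (\<lambda>Y. k (map in_pair X @ Y))"
      by (rule P.wedge_hom_drop_prefix) (use k in \<open>simp add: that n\<close>)
    then have "wedge_hom sgv sv b (\<lambda>Y. k (map in_pair X @ e # Y))"
      by (rule P.wedge_hom_Cons)
    then show ?thesis unfolding in_pair_eq by (rule wedge_hom_precompose) simp
  qed
  show ?thesis
    unfolding mixed_hom_def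
  proof (intro conjI allI, goal_cases)
    case (1 x v Y)
    show ?case
      using L[of Y "((x, 0), (0, v))"] by (cases "length Y = b") (auto simp: wedge_hom_def linear_zero)
  next
    case (2 X v Y)
    show ?case
      using Vector_Spaces.linear_compose[OF linear_maps(3) P.wedge_hom_slot(1)[OF k, of "map in_pair X" "(0, v)" "map in_pair Y"]]
      by (cases "length X = a \<and> length Y = b") (simp_all only: comp_def simp_thms if_True if_False linear_zero)
  next
    case (3 X x Y)
    show ?case
      using Vector_Spaces.linear_compose[OF linear_maps(4) P.wedge_hom_slot(2)[OF k, of "map in_pair X" "(x, 0)" "map in_pair Y"]]
      by (cases "length X = a \<and> length Y = b") (simp_all only: comp_def simp_thms if_True if_False VV.linear_zero)
  next
    case (4 X x v)
    show ?case
      using R[of X "((x, 0), (0, v))"] by (cases "length X = a") (auto simp: wedge_hom_def linear_zero)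
  qed
qed

lemma restr_in_components:
  assumes F: "equivariant n F" and n: "n \<ge> 1"
  shows "restr n F \<in> components_space sg sv n"
proof -
  have f: "wedge_hom sgv sgv n (fst F)" and g: "\<And>z. wedge_hom sgv sgv n (\<lambda>X. snd F X z)"
    and gl: "\<And>X. Vector_Spaces.linear sgv sgv (snd F X)"
    using F by (auto simp: equivariant_def)
  have slot: "n = i - 1 + Suc (n - i)" if "i \<in> {1..n}" for i using that n by auto
  have slot': "n = i - 1 + Suc (n - i)" if "i \<in> {1..n - 1}" for i using that n by auto
  note f' = wedge_hom_compose[OF f linear_maps(1)] wedge_hom_compose[OF f linear_maps(2)]
  note g' = wedge_hom_compose[OF g linear_maps(1)] wedge_hom_compose[OF g linear_maps(2)]
  note pre = wedge_hom_precompose[where s = sg and s' = sgv and \<phi> = "\<lambda>x. (x, 0)", folded in_pair_eq, OF _ linear_maps(3)]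
  note gl' = gl[unfolded Vector_Spaces.linear_iff]
  have g1: "Vector_Spaces.linear sg sg (\<lambda>z. fst (snd F X (z, 0)))" and g2: "Vector_Spaces.linear sv sv (\<lambda>v. snd (snd F X (0, v)))"
    and g3: "Vector_Spaces.linear sg sv (\<lambda>z. snd (snd F X (z, 0)))" for X
    using Vector_Spaces.linear_compose[OF Vector_Spaces.linear_compose[OF linear_maps(3) gl] linear_maps(1), of X]
      Vector_Spaces.linear_compose[OF Vector_Spaces.linear_compose[OF linear_maps(4) gl] linear_maps(2), of X]
      Vector_Spaces.linear_compose[OF Vector_Spaces.linear_compose[OF linear_maps(3) gl] linear_maps(2), of X]
    by (simp_all add: comp_def)
  have f2: "mixed_hom sg sv (n - 1) 0 (\<lambda>X x v Y. if length X = n - 1 \<and> length Y = 0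
      then snd (fst F (map in_pair X @ ((x, 0), (0, v)) # map in_pair Y)) else 0)"
    by (rule mixed_hom_mixed_part[OF f'(2)]) (use n in simp)
  have f2_off: "(if length X = n - 1 then snd (fst F (map in_pair X @ [((x, 0), (0, v))])) else 0)
      = snd (fst F (map in_pair X @ [((x, 0), (0, v))]))" for X x v
    using f n by (auto simp: wedge_hom_def)
  have f2': "wedge_hom sg sv (n - 1) (\<lambda>X. snd (fst F (map in_pair X @ [((x, 0), (0, v))])))"
    "Vector_Spaces.linear sg sv (\<lambda>x. snd (fst F (map in_pair X @ [((x, 0), (0, v))])))"
    "Vector_Spaces.linear sv sv (\<lambda>v. snd (fst F (map in_pair X @ [((x, 0), (0, v))])))" for X x v
  proof -
    note m = f2[unfolded mixed_hom_def]
    show "wedge_hom sg sv (n - 1) (\<lambda>X. snd (fst F (map in_pair X @ [((x, 0), (0, v))])))"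
      using m[THEN conjunct1, THEN spec[of _ x], THEN spec[of _ v], THEN spec[of _ "[]"]]
      by (simp only: list.map list.size f2_off simp_thms)
    show "Vector_Spaces.linear sg sv (\<lambda>x. snd (fst F (map in_pair X @ [((x, 0), (0, v))])))"
      using m[THEN conjunct2, THEN conjunct1, THEN spec[of _ X], THEN spec[of _ v], THEN spec[of _ "[]"]]
      by (simp only: list.map list.size f2_off simp_thms)
    show "Vector_Spaces.linear sv sv (\<lambda>v. snd (fst F (map in_pair X @ [((x, 0), (0, v))])))"
      using m[THEN conjunct2, THEN conjunct2, THEN conjunct1, THEN spec[of _ X], THEN spec[of _ x], THEN spec[of _ "[]"]]
      by (simp only: list.map list.size f2_off simp_thms)
  qed
  show ?thesis
    unfolding components_space_def restr_eq mem_Collect_eq prod.case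
  proof (intro conjI allI ballI impI, goal_cases)
    case 1 show ?case by (rule pre[OF f'(1)])
  next
    case (2 z) show ?case by (rule pre[OF g'(1)])
  next
    case (3 X) show ?case by (rule g1)
  next
    case (4 x v) show ?case by (rule f2')
  next
    case (5 X v) show ?case by (rule f2')
  next
    case (6 X x) show ?case by (rule f2')
  next
    case (7 v) show ?case by (rule pre[OF g'(2)])
  next
    case (8 X) show ?case by (rule g2)
  next
    case (9 i)
    then show ?case
      using mixed_hom_mixed_part[OF f'(2) slot'[OF 9]] by simp
  next
    case (10 i) then show ?case by (simp only: fun_eq_iff if_False simp_thms) simp
  next
    case (11 j z)
    then show ?case
      using mixed_hom_mixed_part[OF g'(2) slot[OF 11], of "(z, 0)"] by simp
  next
    case (12 j X x v Y)
    show ?case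
      using g3 by (cases "j \<in> {1..n} \<and> length X = j - 1 \<and> length Y = n - j") (simp_all only: simp_thms if_True if_False linear_zero)
  next
    case (13 j) then show ?case by (simp only: fun_eq_iff if_False simp_thms) simp
  qed
qed

text \<open>
  Injectivity of \<open>restr\<close> on equivariant cochains turns the previous inverse law into the other one:
  a cochain and the lift of its restriction are both equivariant and have the same restriction.
\<close>
lemma lift_restr:
  assumes F: "equivariant n F" and n: "n \<ge> 1"
  shows "lift n (restr n F) = F"
proof -
  have c: "restr n F \<in> components_space sg sv n" by (rule restr_in_components[OF F n])
  have "lift n (restr n F) - F = 0"
  proof (rule restr_zero_imp_zero)
    show "equivariant n (lift n (restr n F) - F)" by (rule equivariant_diff[OF equivariant_lift[OF c n] F])
    show "restr n (lift n (restr n F) - F) = 0" by (simp add: restr_diff restr_lift[OF c n])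
  qed
  then show ?thesis by simp
qed

definition lift_scale where
  "lift_scale a F = (\<lambda>X. sgv a (fst F X), \<lambda>X z. sgv a (snd F X z))"

lemma double_V_add: "double_V (p + q) = double_V p + double_V q"
  by (simp add: double_V_def vs2.scale_right_distrib)

lemma equivariant_zero: "equivariant n 0"
proof -
  interpret P: vector_space_pair sgv sgv by (simp add: vector_space_pair_def)
  have "double_V 0 = 0" by (simp add: double_V_def zero_prod_def)
  then show ?thesis
    by (simp add: equivariant_def P.wedge_hom_zero P.linear_zero zero_fun_def)
qed

lemma equivariant_add: "equivariant n F \<Longrightarrow> equivariant n G \<Longrightarrow> equivariant n (F + G)"
  using equivariant_diff[OF _ equivariant_diff[OF equivariant_zero], of n F G] by simp

lemma equivariant_scale: "equivariant n F \<Longrightarrow> equivariant n (lift_scale a F)"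
proof -
  interpret P: vector_space_pair sgv sgv by (simp add: vector_space_pair_def)
  have "double_V (sgv a p) = sgv a (double_V p)" for p
    by (cases p) (simp add: double_V_simps vs2.scale_left_commute)
  then show "equivariant n F \<Longrightarrow> equivariant n (lift_scale a F)"
    unfolding equivariant_def lift_scale_def
    by (simp add: P.wedge_hom_scale P.linear_compose_scale_right)
qed

lemma restr_zero: "restr n 0 = 0"
  using restr_diff[of n 0 0] by simp

lemma restr_add: "restr n (F + G) = restr n F + restr n G"
  using restr_diff[of n "F + G" G] by (simp add: algebra_simps)

lemma pair_scale_apply:
  "pair_scale sg sv a (h, (f1, g1, f2, g2, f3, g3)) =
    ((\<lambda>x. sg a (fst h x), \<lambda>u. sv a (snd h u)),
     (\<lambda>X. sg a (f1 X), \<lambda>X z. sg a (g1 X z), \<lambda>X x v. sv a (f2 X x v), \<lambda>X v. sv a (g2 X v),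
      \<lambda>i X x v Y. sv a (f3 i X x v Y), \<lambda>j X x v Y z. sv a (g3 j X x v Y z)))"
  by (cases h) (simp add: pair_scale_def)

lemma pair_scale_restr: "pair_scale sg sv a (0, restr n F) = (0, restr n (lift_scale a F))"
  unfolding restr_eq pair_scale_apply by (auto simp: lift_scale_def fun_eq_iff zero_prod_def)

lemma pair_scale_degree1:
  "pair_scale sg sv a (h, 0) = ((\<lambda>x. sg a (fst h x), \<lambda>v. sv a (snd h v)), 0)"
  by (auto simp: pair_scale_apply zero_prod_def fun_eq_iff)

text \<open>
  Since \<open>restr\<close> is additive and a bijection from the equivariant cochains, which are closed under addition,
  its image is closed under addition as well and the inverse \<open>lift\<close> is additive.
\<close>
lemma components_space_add:
  assumes "c \<in> components_space sg sv n" "c' \<in> components_space sg sv n" "n \<ge> 1"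
  shows "c + c' \<in> components_space sg sv n" "lift n (c + c') = lift n c + lift n c'"
proof -
  have r: "c + c' = restr n (lift n c + lift n c')"
    by (simp only: restr_add restr_lift[OF assms(1,3)] restr_lift[OF assms(2,3)])
  have w: "equivariant n (lift n c + lift n c')"
    by (intro equivariant_add equivariant_lift assms)
  show "c + c' \<in> components_space sg sv n"
    unfolding r by (rule restr_in_components[OF w assms(3)])
  show "lift n (c + c') = lift n c + lift n c'"
    unfolding r by (rule lift_restr[OF w assms(3)])
qed

lemma components_space_scale:
  assumes "c \<in> components_space sg sv n" "n \<ge> 1"
  obtains c' where "c' \<in> components_space sg sv n" "pair_scale sg sv a (0, c) = (0, c')"
    "lift n c' = lift_scale a (lift n c)"
proof -
  have w: "equivariant n (lift_scale a (lift n c))"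
    by (intro equivariant_scale equivariant_lift assms)
  show thesis
  proof (rule that)
    show "restr n (lift_scale a (lift n c)) \<in> components_space sg sv n"
      by (rule restr_in_components[OF w assms(2)])
    show "pair_scale sg sv a (0, c) = (0, restr n (lift_scale a (lift n c)))"
      using pair_scale_restr[of a n "lift n c"] by (simp add: restr_lift[OF assms])
    show "lift n (restr n (lift_scale a (lift n c))) = lift_scale a (lift n c)"
      by (rule lift_restr[OF w assms(2)])
  qed
qed

lemma components_space_zero: "n \<ge> 1 \<Longrightarrow> 0 \<in> components_space sg sv n"
  using restr_in_components[OF equivariant_zero, of n] by (simp add: restr_zero)

lemma vector_space_pair_scale: "vector_space (pair_scale sg sv)"
  by (auto simp: vector_space_def pair_scale_def prod_eq_iff fun_eq_iff split_def
      vs1.scale_right_distrib vs1.scale_left_distrib vs2.scale_right_distrib vs2.scale_left_distrib)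

end

section \<open>The complex of the pair\<close>

context ly_representation
begin

interpretation DS: direct_sum sg sv ..

abbreviation "B \<equiv> semi_br br \<rho>"
abbreviation "T \<equiv> semi_tr br tr \<rho> \<mu>"

interpretation S: lie_yamaguti_algebra "prod_scale sg sv" B T
  by (rule semidirect_product)

interpretation A: ly_representation "prod_scale sg sv" B T "prod_scale sg sv" B "adj_mu T"
  by (rule S.adjoint_representation)

abbreviation "pack F \<equiv> \<lambda>X. (fst F X, snd F X)"

lemma equivariant_cochain: "DS.equivariant n F \<Longrightarrow> A.L.cochain n (pack F)"
  by (simp add: DS.equivariant_def A.cochain_iff)

lemma yam_delta_semi:
  "A.L.cochain n (pack F) \<Longrightarrow> yam_delta B T B (adj_mu T) n F =
    (\<lambda>X. fst (A.L.coboundary (pack F) X), \<lambda>X. snd (A.L.coboundary (pack F) X))"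
  using A.yam_delta_eq_coboundary[of n "pack F"] by simp

lemma semi_double_V: "B (DS.double_V p) (DS.double_V q) = DS.double_V (B p q)" "T (DS.double_V p) (DS.double_V q) (DS.double_V e) = DS.double_V (T p q e)"
  by (cases p; cases q; cases e; simp add: semi_br_def semi_tr_def DS.double_V_def
      V.scale_right_diff_distrib V.scale_right_distrib)+

definition halve_V where "halve_V p = (fst p, sv (1 / 2) (snd p))"

lemma halve_V [simp]: "DS.double_V (halve_V p) = p" "halve_V (DS.double_V p) = p"
  by (simp_all add: halve_V_def DS.double_V_def)

text \<open>
  The action of $\sigma$ on the coefficients. On $\mathrm{Hom}(\mathfrak g\oplus V,\mathfrak g\oplus V)$ it is conjugation by
  $\sigma$, which needs the inverse $\sigma^{-1}(x+u)=x+u/2$.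
\<close>
definition twist where "twist m = (DS.double_V (fst m), \<lambda>z. DS.double_V (snd m (halve_V z)))"

lemma semi_halve_V: "halve_V (T (DS.double_V p) (DS.double_V q) e) = T p q (halve_V e)"
  by (metis semi_double_V(2) halve_V)

text \<open>$\sigma$ is an automorphism of $\mathfrak g\ltimes V$, and the coboundary is natural.\<close>
lemma coboundary_twist:
  assumes "\<And>X. F (DS.double_Vs X) = twist (F X)"
  shows "A.L.coboundary F (DS.double_Vs X) = twist (A.L.coboundary F X)"
proof (rule A.L.coboundary_natural)
  have d: "DS.double_V (p - q) = DS.double_V p - DS.double_V q" for p q
    by (simp add: DS.double_V_def V.scale_right_diff_distrib)
  note defs = A.coeff_l_def A.coeff_r_def twist_def S.rep_D_adjoint adj_mu_def
  show "T (DS.double_V x) (DS.double_V y) (DS.double_V z) = DS.double_V (T x y z)" for x y z by (rule semi_double_V)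
  show "twist (m + m') = twist m + twist m'" for m m'
    by (simp add: twist_def DS.double_V_add plus_fun_def)
  show "A.coeff_l (DS.double_V x) (DS.double_V y) (twist m) = twist (A.coeff_l x y m)" for x y m
    by (simp add: defs d semi_double_V semi_halve_V)
  show "A.coeff_r (DS.double_V x) (DS.double_V y) (twist m) = twist (A.coeff_r x y m)" for x y m
  proof -
    have "T (DS.double_V p) (DS.double_V q) z = DS.double_V (T p q (halve_V z))"
      "T (DS.double_V p) z (DS.double_V q) = DS.double_V (T p (halve_V z) q)" for p q z
      using semi_double_V(2)[of p q "halve_V z"] semi_double_V(2)[of p "halve_V z" q] by simp_all
    then show ?thesis
      by (simp add: defs d DS.double_V_add semi_double_V(1) fun_eq_iff)
  qed
qed (rule assms)

lemma equivariant_twist: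
  assumes "DS.equivariant n F"
  shows "pack F (DS.double_Vs X) = twist (pack F X)"
proof -
  have F: "fst F (DS.double_Vs X) = DS.double_V (fst F X)" "snd F (DS.double_Vs X) (DS.double_V z) = DS.double_V (snd F X z)" for z
    using assms unfolding DS.equivariant_def by blast+
  have "snd F (DS.double_Vs X) z = DS.double_V (snd F X (halve_V z))" for z
    using F(2)[of "halve_V z"] by simp
  then show ?thesis by (simp add: F(1) twist_def fun_eq_iff)
qed

lemma equivariantI:
  assumes "A.L.cochain n G" "\<And>X. G (DS.double_Vs X) = twist (G X)"
  shows "DS.equivariant n (\<lambda>X. fst (G X), \<lambda>X. snd (G X))"
  using assms by (simp add: DS.equivariant_def A.cochain_iff twist_def)

lemma equivariant_yam_delta:
  assumes F: "DS.equivariant n F"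
  shows "DS.equivariant (Suc n) (yam_delta B T B (adj_mu T) n F)"
  unfolding yam_delta_semi[OF equivariant_cochain[OF F]]
  by (rule equivariantI[OF A.L.cochain_coboundary[OF equivariant_cochain[OF F]]], rule coboundary_twist, rule equivariant_twist[OF F])

lemma yam_delta_yam_delta:
  assumes F: "DS.equivariant n F"
  shows "yam_delta B T B (adj_mu T) (Suc n) (yam_delta B T B (adj_mu T) n F) = 0"
proof -
  note c = equivariant_cochain[OF F]
  have "yam_delta B T B (adj_mu T) (Suc n) (yam_delta B T B (adj_mu T) n F) =
    (\<lambda>X. fst (A.L.coboundary (A.L.coboundary (pack F)) X), \<lambda>X. snd (A.L.coboundary (A.L.coboundary (pack F)) X))"
    unfolding yam_delta_semi[OF c] by (rule A.yam_delta_eq_coboundary[OF A.L.cochain_coboundary[OF c]])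
  then show ?thesis
    by (simp add: A.L.coboundary_coboundary[OF c] zero_prod_def zero_fun_def)
qed

lemma yam_delta_add:
  assumes "DS.equivariant n F" "DS.equivariant n G"
  shows "yam_delta B T B (adj_mu T) n (F + G) = yam_delta B T B (adj_mu T) n F + yam_delta B T B (adj_mu T) n G"
proof -
  have "pack (F + G) = (\<lambda>X. pack F X + pack G X)" by (simp add: fun_eq_iff)
  then show ?thesis
    by (simp only: yam_delta_semi[OF equivariant_cochain] assms DS.equivariant_add A.L.coboundary_add)
      (simp add: prod_eq_iff fun_eq_iff)
qed

lemma yam_delta_scale:
  assumes "DS.equivariant n F"
  shows "yam_delta B T B (adj_mu T) n (DS.lift_scale a F) = DS.lift_scale a (yam_delta B T B (adj_mu T) n F)"
proof -
  have "pack (DS.lift_scale a F) = (\<lambda>X. A.coeff_scale a (pack F X))"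
    by (simp add: fun_eq_iff DS.lift_scale_def A.coeff_scale_def)
  then show ?thesis
    by (simp only: yam_delta_semi[OF equivariant_cochain] assms DS.equivariant_scale A.L.coboundary_scale)
      (simp add: fun_eq_iff DS.lift_scale_def A.coeff_scale_def)
qed

abbreviation at_Nil ::
  "('g \<times> 'v \<Rightarrow> 'g \<times> 'v) \<Rightarrow> (('g \<times> 'v) \<times> ('g \<times> 'v)) list \<Rightarrow> ('g \<times> 'v) \<times> ('g \<times> 'v \<Rightarrow> 'g \<times> 'v)"
  where "at_Nil h \<equiv> \<lambda>X. if X = [] then (0, h) else 0"

abbreviation "linear_pair h \<equiv> Vector_Spaces.linear sg sg (fst h) \<and> Vector_Spaces.linear sv sv (snd h)"

lemma lift1_apply: "lift1 h p = (fst h (fst p), snd h (snd p))"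
  by (simp add: lift1_def split_def)

lemma lift1_linear: "linear_pair h \<Longrightarrow> Vector_Spaces.linear (prod_scale sg sv) (prod_scale sg sv) (lift1 h)"
  by (simp add: Vector_Spaces.linear_iff lift1_apply prod_eq_iff)

lemma yam_delta1_semi:
  assumes "linear_pair h"
  shows "A.L.cochain 0 (at_Nil (lift1 h))"
    and "yam_delta1 B T B (adj_mu T) (lift1 h) =
      (\<lambda>X. fst (A.L.coboundary (at_Nil (lift1 h)) X), \<lambda>X. snd (A.L.coboundary (at_Nil (lift1 h)) X))"
  using A.yam_delta1_eq_coboundary[OF lift1_linear[OF assms]] by simp_all

lemma equivariant_yam_delta1:
  assumes h: "linear_pair h"
  shows "DS.equivariant 1 (yam_delta1 B T B (adj_mu T) (lift1 h))"
proof -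
  have "at_Nil (lift1 h) (DS.double_Vs X) = twist (at_Nil (lift1 h) X)" for X
  proof -
    have e: "DS.double_V (lift1 h (halve_V p)) = lift1 h p" for p
    proof -
      interpret Vector_Spaces.linear sv sv "snd h" using h by simp
      show ?thesis by (simp add: lift1_apply DS.double_V_def halve_V_def scale)
    qed
    have "DS.double_V 0 = 0" by (simp add: DS.double_V_def zero_prod_def)
    then show ?thesis
      by (simp add: twist_def e zero_prod_def zero_fun_def)
  qed
  then show ?thesis
    unfolding yam_delta1_semi(2)[OF h] One_nat_def
    by (intro equivariantI A.L.cochain_coboundary yam_delta1_semi(1)[OF h] coboundary_twist)
qed

lemma yam_delta_yam_delta1:
  assumes h: "linear_pair h"
  shows "yam_delta B T B (adj_mu T) 1 (yam_delta1 B T B (adj_mu T) (lift1 h)) = 0"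
proof -
  note c = yam_delta1_semi(1)[OF h]
  have "yam_delta B T B (adj_mu T) (Suc 0) (yam_delta1 B T B (adj_mu T) (lift1 h)) =
    (\<lambda>X. fst (A.L.coboundary (A.L.coboundary (at_Nil (lift1 h))) X), \<lambda>X. snd (A.L.coboundary (A.L.coboundary (at_Nil (lift1 h))) X))"
    unfolding yam_delta1_semi(2)[OF h] by (rule A.yam_delta_eq_coboundary[OF A.L.cochain_coboundary[OF c]])
  then show ?thesis
    by (simp add: A.L.coboundary_coboundary[OF c] zero_prod_def zero_fun_def)
qed

lemma linear_pair_add: "linear_pair h \<Longrightarrow> linear_pair h' \<Longrightarrow> linear_pair (h + h')"
  by (simp add: Vector_Spaces.linear_iff algebra_simps scale_right_distrib V.scale_right_distrib)

lemma linear_pair_scale: "linear_pair h \<Longrightarrow> linear_pair (\<lambda>x. sg a (fst h x), \<lambda>v. sv a (snd h v))"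
  by (simp add: Vector_Spaces.linear_iff scale_right_distrib V.scale_right_distrib scale_left_commute V.scale_left_commute)

lemma yam_delta1_add:
  assumes "linear_pair h" "linear_pair h'"
  shows "yam_delta1 B T B (adj_mu T) (lift1 (h + h')) =
    yam_delta1 B T B (adj_mu T) (lift1 h) + yam_delta1 B T B (adj_mu T) (lift1 h')"
proof -
  have e: "at_Nil (lift1 (h + h')) = (\<lambda>X. at_Nil (lift1 h) X + at_Nil (lift1 h') X)"
    by (auto simp: fun_eq_iff lift1_apply)
  show ?thesis
    unfolding yam_delta1_semi(2)[OF assms(1)] yam_delta1_semi(2)[OF assms(2)]
      yam_delta1_semi(2)[OF linear_pair_add[OF assms]] e A.L.coboundary_add
    by (simp add: fun_eq_iff)
qed

lemma yam_delta1_scale: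
  assumes "linear_pair h"
  shows "yam_delta1 B T B (adj_mu T) (lift1 (\<lambda>x. sg a (fst h x), \<lambda>v. sv a (snd h v))) =
    DS.lift_scale a (yam_delta1 B T B (adj_mu T) (lift1 h))"
proof -
  have e: "at_Nil (lift1 (\<lambda>x. sg a (fst h x), \<lambda>v. sv a (snd h v))) = (\<lambda>X. A.coeff_scale a (at_Nil (lift1 h) X))"
    by (auto simp: fun_eq_iff lift1_apply A.coeff_scale_def zero_prod_def)
  show ?thesis
    unfolding yam_delta1_semi(2)[OF assms(1)] yam_delta1_semi(2)[OF linear_pair_scale[OF assms]] e A.L.coboundary_scale
    by (simp add: fun_eq_iff DS.lift_scale_def A.coeff_scale_def)
qed

abbreviation "\<Delta> \<equiv> pair_delta br tr \<rho> \<mu>"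
abbreviation "C \<equiv> pair_cochains sg sv"

lemma C_0: "C 0 = {0}"
  by (simp add: pair_cochains_def)

lemma C_1: "(h, 0) \<in> C (Suc 0) \<longleftrightarrow> linear_pair h"
  by (cases h) (simp add: pair_cochains_def)

lemma C_Suc: "n \<ge> 1 \<Longrightarrow> (0, c) \<in> C (Suc n) \<longleftrightarrow> c \<in> components_space sg sv n"
  by (simp add: pair_cochains_def)

lemma C_1E:
  assumes "c \<in> C (Suc 0)"
  obtains h where "linear_pair h" "c = (h, 0)"
  using assms that[of "fst c"] by (cases c) (auto simp: pair_cochains_def)

lemma C_SucE:
  assumes "c \<in> C (Suc n)" "n \<ge> 1"
  obtains c' where "c' \<in> components_space sg sv n" "c = (0, c')"
  using assms that[of "snd c"] by (cases c) (auto simp: pair_cochains_def)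

lemma \<Delta>_simps:
  "\<Delta> 0 c = 0"
  "\<Delta> (Suc 0) (h, 0) = (0, restr 1 (yam_delta1 B T B (adj_mu T) (lift1 h)))"
  "n \<ge> 1 \<Longrightarrow> \<Delta> (Suc n) (0, c') = (0, restr (Suc n) (yam_delta B T B (adj_mu T) n (lift n c')))"
  by (simp_all add: pair_delta_def Let_def)

text \<open>The three cases in which the cochain spaces of the pair and \<open>\<Delta>\<close> are defined differently.\<close>
lemma degree_cases:
  obtains "p = 0" | "p = Suc 0" | n where "n \<ge> 1" "p = Suc n"
  by (cases p) (force simp: Suc_le_eq)+

lemma zero_cochain: "(0 :: ('g, 'v) pair_cochain) = (0, 0)"
  by (rule zero_prod_def)

lemma zero_in_C: "0 \<in> C p"
proof (cases p rule: degree_cases)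
  case 1
  then show ?thesis by (simp add: C_0)
next
  case 2
  have "linear_pair 0"
    by (simp add: Vector_Spaces.linear_iff vector_space_axioms V.vector_space_axioms)
  then show ?thesis unfolding 2 zero_cochain C_1 .
next
  case (3 n)
  show ?thesis
    unfolding 3(2) zero_cochain C_Suc[OF 3(1)] by (rule DS.components_space_zero[OF 3(1)])
qed

lemma pair_scale_zero: "pair_scale sg sv a 0 = 0"
proof -
  interpret PC: vector_space "pair_scale sg sv" by (rule DS.vector_space_pair_scale)
  show ?thesis by simp
qed

lemma C_add:
  assumes c: "c \<in> C p" "c' \<in> C p"
  shows "c + c' \<in> C p" and "\<Delta> p (c + c') = \<Delta> p c + \<Delta> p c'"
proof -
  have "c + c' \<in> C p \<and> \<Delta> p (c + c') = \<Delta> p c + \<Delta> p c'"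
  proof (cases p rule: degree_cases)
    case 1
    then show ?thesis using c by (simp add: C_0 \<Delta>_simps)
  next
    case 2
    obtain h h' where h: "linear_pair h" "c = (h, 0)" "linear_pair h'" "c' = (h', 0)"
      using c unfolding 2 by (elim C_1E)
    have e: "c + c' = (h + h', 0)" by (simp add: h)
    show ?thesis
      unfolding 2 e C_1 unfolding h \<Delta>_simps yam_delta1_add[OF h(1,3)] DS.restr_add
      using linear_pair_add[OF h(1,3)] by simp
  next
    case (3 n)
    obtain a a' where a: "a \<in> components_space sg sv n" "c = (0, a)"
      "a' \<in> components_space sg sv n" "c' = (0, a')"
      using c unfolding 3(2) by (elim C_SucE[OF _ 3(1)])
    have e: "c + c' = (0, a + a')" by (simp add: a)
    note add = DS.components_space_add[OF a(1,3) 3(1)]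
    show ?thesis
      unfolding 3(2) e C_Suc[OF 3(1)] unfolding a \<Delta>_simps(3)[OF 3(1)] add(2) DS.restr_add
        yam_delta_add[OF DS.equivariant_lift[OF a(1) 3(1)] DS.equivariant_lift[OF a(3) 3(1)]]
      using add(1) by simp
  qed
  then show "c + c' \<in> C p" "\<Delta> p (c + c') = \<Delta> p c + \<Delta> p c'" by simp_all
qed

lemma C_scale:
  assumes c: "c \<in> C p"
  shows "pair_scale sg sv a c \<in> C p" and "\<Delta> p (pair_scale sg sv a c) = pair_scale sg sv a (\<Delta> p c)"
proof -
  have "pair_scale sg sv a c \<in> C p \<and> \<Delta> p (pair_scale sg sv a c) = pair_scale sg sv a (\<Delta> p c)"
  proof (cases p rule: degree_cases)
    case 1
    then show ?thesis using c by (simp add: C_0 \<Delta>_simps pair_scale_zero)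
  next
    case 2
    obtain h where h: "linear_pair h" "c = (h, 0)"
      using c unfolding 2 by (elim C_1E)
    show ?thesis
      unfolding 2 h DS.pair_scale_degree1 \<Delta>_simps yam_delta1_scale[OF h(1)] DS.pair_scale_restr C_1
      using linear_pair_scale[OF h(1)] by simp
  next
    case (3 n)
    obtain b where b: "b \<in> components_space sg sv n" "c = (0, b)"
      using c unfolding 3(2) by (elim C_SucE[OF _ 3(1)])
    obtain b' where b': "b' \<in> components_space sg sv n" "pair_scale sg sv a (0, b) = (0, b')"
      "lift n b' = DS.lift_scale a (lift n b)"
      using DS.components_space_scale[OF b(1) 3(1)] by blast
    show ?thesis
      unfolding 3(2) b(2) b'(2) \<Delta>_simps(3)[OF 3(1)] b'(3) yam_delta_scale[OF DS.equivariant_lift[OF b(1) 3(1)]]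
        DS.pair_scale_restr C_Suc[OF 3(1)] using b'(1) by simp
  qed
  then show "pair_scale sg sv a c \<in> C p" "\<Delta> p (pair_scale sg sv a c) = pair_scale sg sv a (\<Delta> p c)"
    by simp_all
qed

text \<open>
  In positive degrees \<open>\<Delta>\<close> is the restriction of an equivariant coboundary, and lifting
  that restriction recovers the coboundary itself. Therefore a second application of \<open>\<Delta>\<close>
  restricts $\delta\delta=0$.
\<close>
lemma \<Delta>_C:
  assumes c: "c \<in> C p"
  shows "\<Delta> p c \<in> C (Suc p)" and "\<Delta> (Suc p) (\<Delta> p c) = 0"
proof -
  have "\<Delta> p c \<in> C (Suc p) \<and> \<Delta> (Suc p) (\<Delta> p c) = 0"
  proof (cases p rule: degree_cases)
    case 1
    have "\<Delta> (Suc 0) (0 + 0) = \<Delta> (Suc 0) 0 + \<Delta> (Suc 0) 0"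
      by (rule C_add) (rule zero_in_C)+
    then show ?thesis using zero_in_C[of "Suc 0"] by (simp add: 1 \<Delta>_simps)
  next
    case 2
    obtain h where h: "linear_pair h" "c = (h, 0)"
      using c unfolding 2 by (elim C_1E)
    have n: "Suc 0 \<ge> 1" by simp
    note w = equivariant_yam_delta1[OF h(1), unfolded One_nat_def]
    show ?thesis
      unfolding 2 h(2) \<Delta>_simps(2) \<Delta>_simps(3)[OF n] C_Suc[OF n] One_nat_def DS.lift_restr[OF w n]
        yam_delta_yam_delta1[OF h(1), unfolded One_nat_def] DS.restr_zero zero_cochain
      using DS.restr_in_components[OF w n] by simp
  next
    case (3 n)
    obtain b where b: "b \<in> components_space sg sv n" "c = (0, b)"
      using c unfolding 3(2) by (elim C_SucE[OF _ 3(1)])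
    have n: "Suc n \<ge> 1" by simp
    note w = DS.equivariant_lift[OF b(1) 3(1)]
    note w' = equivariant_yam_delta[OF w]
    show ?thesis
      unfolding 3(2) b(2) \<Delta>_simps(3)[OF 3(1)] \<Delta>_simps(3)[OF n] C_Suc[OF n] DS.lift_restr[OF w' n]
        yam_delta_yam_delta[OF w] DS.restr_zero zero_cochain
      using DS.restr_in_components[OF w' n] by simp
  qed
  then show "\<Delta> p c \<in> C (Suc p)" "\<Delta> (Suc p) (\<Delta> p c) = 0" by simp_all
qed

end

theorem theorem3p1:
  fixes sg :: "'k::field_char_0 \<Rightarrow> 'g::ab_group_add \<Rightarrow> 'g"
    and sv :: "'k \<Rightarrow> 'v::ab_group_add \<Rightarrow> 'v"
    and Bg :: "'g set" and Bv :: "'v set"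
    and br :: "'g \<Rightarrow> 'g \<Rightarrow> 'g"
    and tr :: "'g \<Rightarrow> 'g \<Rightarrow> 'g \<Rightarrow> 'g"
    and \<rho> :: "'g \<Rightarrow> 'v \<Rightarrow> 'v"
    and \<mu> :: "'g \<Rightarrow> 'g \<Rightarrow> 'v \<Rightarrow> 'v"
  assumes "finite_dimensional_vector_space sg Bg"
    and "finite_dimensional_vector_space sv Bv"
    and "lie_yamaguti_algebra sg br tr"
    and "ly_representation sg br tr sv \<rho> \<mu>"
  shows "(\<forall>p. \<forall>c \<in> pair_cochains sg sv p.
            pair_delta br tr \<rho> \<mu> (Suc p) (pair_delta br tr \<rho> \<mu> p c) = 0) \<and>
         cochain_complex (pair_scale sg sv) (pair_cochains sg sv) (pair_delta br tr \<rho> \<mu>)"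
proof -
  interpret R: ly_representation sg br tr sv \<rho> \<mu> by fact
  interpret DS: direct_sum sg sv ..
  interpret PC: vector_space "pair_scale sg sv" by (rule DS.vector_space_pair_scale)
  have "PC.subspace (pair_cochains sg sv p)" for p
    unfolding PC.subspace_def using R.zero_in_C R.C_add(1) R.C_scale(1) by blast
  then have "cochain_complex (pair_scale sg sv) (pair_cochains sg sv) (pair_delta br tr \<rho> \<mu>)"
    unfolding cochain_complex_def
    using PC.vector_space_axioms R.\<Delta>_C R.C_add(2) R.C_scale(2) by (simp add: image_subset_iff)
  then show ?thesis using R.\<Delta>_C(2) by blast
qed

end
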